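(* Let ${\mathscr X}$ be a Polish space with countable basis ${\mathscr U}$, let $\hat{\mathscr X}$ be the associated zero-dimensional refinement, and let ${\mathscr A}$ be a set of finite partitions generated by ${\mathscr U}$, directed under refinement, that resolves ${\mathscr X}$. Equip $M^1({\mathscr X})$ with the tight topology. Let $(\Pi_\alpha)_{\alpha\in{\mathscr A}}$ be a coherent system of Borel probability measures on the simplices $M^1({\mathscr X}_\alpha)$. Then there exists a unique Radon probability measure $\Pi$ on $M^1({\mathscr X})$ projecting to $\Pi_\alpha$ for all $\alpha\in{\mathscr A}$ if and only if for every $\epsilon,\delta>0$ there is a compact $\hat K\subset\hat{\mathscr X}$ such that $$\Pi_\alpha\Bigl(\Bigl\{P_\alpha\in M^1({\mathscr X}_\alpha):\sum_{A\in\alpha,\;A\cap\hat K\neq\emptyset}P_\alpha(A)<1-\delta\Bigr\}\Bigr)<\epsilon\quad\text{for all }\alpha\in{\mathscr A}.$$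
   Context: $\hat{\mathscr X}$: the set ${\mathscr X}$ with topology generated by the subbasis $\{U,{\mathscr X}\setminus U:U\in{\mathscr U}\}$. A partition $\alpha$ (finite collection of non-empty disjoint Borel sets covering ${\mathscr X}$) is generated by ${\mathscr U}$ if each $A\in\alpha$ is a finite union of finite intersections of sets $U$ or ${\mathscr X}\setminus U$, $U\in{\mathscr U}$. ${\mathscr A}$ resolves ${\mathscr X}$ if its partition sets generate the Borel $\sigma$-algebra. $M^1({\mathscr X})$: Radon probability measures; tight topology: coarsest making $P\mapsto\int f\,dP$ continuous for all bounded continuous $f$. $M^1({\mathscr X}_\alpha)$: simplex of probability vectors $(P_\alpha(A))_{A\in\alpha}$; projection $P\mapsto(P(A))_{A\in\alpha}$. Coherence: $\Pi_\alpha=\Pi_\beta\circ\varphi_{\alpha\beta}^{-1}$ for $\alpha\le\beta$ where $(\varphi_{\alpha\beta}p)_A=\sum_{B\in\beta,B\subset A}p_B$. $\Pi$ projects to $\Pi_\alpha$ if $\Pi_\alpha$ is the law of $(P(A))_{A\in\alpha}$ under $P\sim\Pi$. *)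

theory Defs
  imports "HOL-Probability.Probability"
begin

definition Polish_space :: "'a topology \<Rightarrow> bool" where
  "Polish_space X \<longleftrightarrow> completely_metrizable_space X \<and> separable_space X"

definition borel_of :: "'a topology \<Rightarrow> 'a measure" where
  "borel_of T = sigma (topspace T) {U. openin T U}"

definition countable_basis :: "'a topology \<Rightarrow> 'a set set \<Rightarrow> bool" where
  "countable_basis X \<U> \<longleftrightarrow> countable \<U> \<and> (\<forall>V\<in>\<U>. openin X V) \<and>
     (\<forall>W x. openin X W \<and> x \<in> W \<longrightarrow> (\<exists>V\<in>\<U>. x \<in> V \<and> V \<subseteq> W))"

definition hat_top :: "'a topology \<Rightarrow> 'a set set \<Rightarrow> 'a topology" where
  "hat_top X \<U> = topology_generated_by ({topspace X} \<union> \<U> \<union> {topspace X - U | U. U \<in> \<U>})"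

definition radon_prob :: "'a topology \<Rightarrow> 'a measure \<Rightarrow> bool" where
  "radon_prob T M \<longleftrightarrow> prob_space M \<and> sets M = sets (borel_of T) \<and>
     (\<forall>B\<in>sets M. emeasure M B = (SUP K\<in>{K. compactin T K \<and> K \<subseteq> B \<and> K \<in> sets M}. emeasure M K))"

definition M1 :: "'a topology \<Rightarrow> 'a measure set" where
  "M1 X = {P. radon_prob X P}"

definition bounded_continuous :: "'a topology \<Rightarrow> ('a \<Rightarrow> real) \<Rightarrow> bool" where
  "bounded_continuous X f \<longleftrightarrow> continuous_map X euclideanreal f \<and>
     (\<exists>B. \<forall>x\<in>topspace X. \<bar>f x\<bar> \<le> B)"

definition tight_top :: "'a topology \<Rightarrow> 'a measure topology" where
  "tight_top X = topology_generated_by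
     ({M1 X} \<union> {{P \<in> M1 X. integral\<^sup>L P f \<in> V} | f V. bounded_continuous X f \<and> open V})"

definition gen_by :: "'a topology \<Rightarrow> 'a set set \<Rightarrow> 'a set \<Rightarrow> bool" where
  "gen_by X \<U> A \<longleftrightarrow> (\<exists>\<F>. finite \<F> \<and>
     (\<forall>S\<in>\<F>. finite S \<and> S \<subseteq> \<U> \<union> {topspace X - U | U. U \<in> \<U>}) \<and>
     A = (\<Union>S\<in>\<F>. topspace X \<inter> \<Inter>S))"

definition is_partition :: "'a topology \<Rightarrow> 'a set set \<Rightarrow> bool" where
  "is_partition X \<alpha> \<longleftrightarrow> finite \<alpha> \<and> (\<forall>A\<in>\<alpha>. A \<noteq> {} \<and> A \<in> sets (borel_of X)) \<and>
     disjoint \<alpha> \<and> \<Union>\<alpha> = topspace X"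

text \<open>\<open>refines \<beta> \<alpha>\<close> means \<open>\<alpha> \<le> \<beta>\<close>.\<close>
definition refines :: "'a set set \<Rightarrow> 'a set set \<Rightarrow> bool" where
  "refines \<beta> \<alpha> \<longleftrightarrow> (\<forall>B\<in>\<beta>. \<exists>A\<in>\<alpha>. B \<subseteq> A)"

definition directed_refinement :: "'a set set set \<Rightarrow> bool" where
  "directed_refinement \<A> \<longleftrightarrow> \<A> \<noteq> {} \<and>
     (\<forall>\<alpha>\<in>\<A>. \<forall>\<beta>\<in>\<A>. \<exists>\<gamma>\<in>\<A>. refines \<gamma> \<alpha> \<and> refines \<gamma> \<beta>)"

definition resolves :: "'a topology \<Rightarrow> 'a set set set \<Rightarrow> bool" where
  "resolves X \<A> \<longleftrightarrow> sigma_sets (topspace X) (\<Union>\<A>) = sets (borel_of X)"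

definition simplexM :: "'a set set \<Rightarrow> ('a set \<Rightarrow> real) set" where
  "simplexM \<alpha> = {p \<in> extensional \<alpha>. (\<forall>A\<in>\<alpha>. 0 \<le> p A) \<and> (\<Sum>A\<in>\<alpha>. p A) = 1}"

definition simplex_top :: "'a set set \<Rightarrow> ('a set \<Rightarrow> real) topology" where
  "simplex_top \<alpha> = subtopology (product_topology (\<lambda>_. euclideanreal) \<alpha>) (simplexM \<alpha>)"

definition proj :: "'a set set \<Rightarrow> 'a measure \<Rightarrow> ('a set \<Rightarrow> real)" where
  "proj \<alpha> P = restrict (\<lambda>A. measure P A) \<alpha>"

definition phi :: "'a set set \<Rightarrow> 'a set set \<Rightarrow> ('a set \<Rightarrow> real) \<Rightarrow> ('a set \<Rightarrow> real)" where
  "phi \<alpha> \<beta> p = restrict (\<lambda>A. \<Sum>B\<in>{B\<in>\<beta>. B \<subseteq> A}. p B) \<alpha>"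

end

theory Submission
  imports Defs
begin

text \<open>
  The marginals on the countable algebra generated by the partitions extend by Kolmogorov's theorem
  to a law on \<open>\<real>\<^sup>\<nat>\<close>, whose samples are almost surely finitely additive. Members of the algebra are
  clopen in the zero-dimensional refinement, so a decreasing sequence of them with empty intersection
  eventually misses any given compact set there; the tightness condition therefore makes almost every
  sample continuous at the empty set, hence a probability measure on \<open>X\<close>. The law of this random
  measure is Radon because it is the image of a Radon law under a measurable map into a second
  countable Hausdorff space, to which Lusin's theorem applies. Conversely, the mean measure
  \<open>B \<mapsto> \<integral> P(B) d\<Pi>(P)\<close> is a Borel probability measure on \<open>X\<close>, so it is tight even for the refinement,
  again by Lusin's argument, and Markov's inequality transfers this to the projections.
\<close>

subsection \<open>Borel probability measures on Polish spaces\<close>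

text \<open>Cells need be neither open nor closed in \<open>X\<close>, so compactness in
  \<open>X\<close> says nothing about decreasing cell unions; this is why the criterion asks for
  compact sets of the finer topology, and why necessity has to produce such sets. The bridge between
  topology and measure is that the Borel sets of the tight topology coincide with those of
  \<open>prob_algebra\<close>, generated by the evaluations \<open>P \<mapsto> P(B)\<close>. Since
  \<open>\<A>\<close> resolves \<open>X\<close>, evaluations at the cell algebra suffice, and
  measurability questions on \<open>M1 X\<close> become questions about real coordinates. Cells are
  finite Boolean expressions in the countable family \<open>\<U>\<close>, so these coordinates are
  countable in number: the extension lives on the Polish space
  \<open>nat \<Rightarrow> real\<close>, and exceptional null sets can be united. The partitions are
  only directed, not linearly ordered, so each statement about finitely many sets is verified on one
  partition fine enough for all of them. In the criterion one compact set works with probability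
  close to 1; letting \<epsilon> tend to 0 yields, almost surely, a compact set that depends on the
  sample, which is all that the extension of a single sample requires.\<close>

lemma sets_borel_of: "sets (borel_of T) = sigma_sets (topspace T) {U. openin T U}"
  unfolding borel_of_def by (rule sets_measure_of) (auto dest: openin_subset)

lemma space_borel_of [simp]: "space (borel_of T) = topspace T"
  unfolding borel_of_def by (rule space_measure_of) (auto dest: openin_subset)

lemma openin_in_sets_borel_of: "openin T U \<Longrightarrow> U \<in> sets (borel_of T)"
  by (simp add: sets_borel_of)

lemma closedin_in_sets_borel_of:
  assumes "closedin T F" shows "F \<in> sets (borel_of T)"
proof -
  have "topspace T - (topspace T - F) \<in> sets (borel_of T)"
    using assms by (metis openin_in_sets_borel_of closedin_def sets.compl_sets space_borel_of)
  then show ?thesis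
    using closedin_subset[OF assms] by (simp add: double_diff)
qed

lemma measurable_into_borel_of:
  assumes "f \<in> space M \<rightarrow> topspace T" "\<And>U. openin T U \<Longrightarrow> f -` U \<inter> space M \<in> sets M"
  shows "f \<in> M \<rightarrow>\<^sub>M borel_of T"
proof (rule measurable_sigma_sets[OF sets_borel_of])
  show "{U. openin T U} \<subseteq> Pow (topspace T)" using openin_subset by fast
qed (use assms in simp_all)

lemma continuous_map_measurable:
  assumes "continuous_map S T f"
  shows "f \<in> borel_of S \<rightarrow>\<^sub>M borel_of T"
proof (rule measurable_into_borel_of)
  show "f \<in> space (borel_of S) \<rightarrow> topspace T"
    using assms by (simp add: continuous_map_def)
  show "f -` U \<inter> space (borel_of S) \<in> sets (borel_of S)" if "openin T U" for U
    using continuous_map_alt[THEN iffD1, OF assms] that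
    by (auto intro: openin_in_sets_borel_of)
qed

lemma borel_of_euclidean [simp]: "borel_of euclidean = borel"
  by (simp add: borel_of_def borel_def)

text \<open>An open set is the union of the members of \<open>\<B>\<close> inside it, a countable
  union. This is the upper bound on Borel sets used both for topologies with a countable subbase and
  for simplices.\<close>

lemma sets_borel_of_subset_of_base:
  assumes "countable \<B>" "\<B> \<subseteq> \<Sigma>" "sigma_algebra (topspace T) \<Sigma>"
    and base: "\<And>W x. openin T W \<Longrightarrow> x \<in> W \<Longrightarrow> \<exists>V\<in>\<B>. x \<in> V \<and> V \<subseteq> W"
  shows "sets (borel_of T) \<subseteq> \<Sigma>"
proof -
  interpret sigma_algebra "topspace T" \<Sigma> by fact
  have "U \<in> \<Sigma>" if "openin T U" for U
  proof -
    have "U = \<Union>{V\<in>\<B>. V \<subseteq> U}" using base[OF that] by blast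
    also have "\<dots> \<in> \<Sigma>"
      using assms by (intro countable_Union) (auto intro: countable_subset)
    finally show ?thesis .
  qed
  then show ?thesis
    unfolding sets_borel_of by (intro sigma_sets_subset) auto
qed

section \<open>Regularity and tightness of finite Borel measures\<close>

text \<open>Countably many errors use up only \<open>e / 2\<close>; the other half pays for one
  further approximation or keeps the final inequality strict.\<close>

lemma geometric_budget:
  fixes e :: real
  shows "(\<lambda>n. e / 4 * (1/2) ^ n) sums (e / 2)"
  using sums_mult[OF geometric_sums[of "1/2::real"], of "e/4"] by simp

lemma measure_UN_le_geometric:
  fixes A :: "nat \<Rightarrow> 'a set"
  assumes "finite_measure M" "\<And>n. A n \<in> sets M" "\<And>n. measure M (A n) \<le> e / 4 * (1/2) ^ n"
  shows "measure M (\<Union>n. A n) \<le> e / 2"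
proof -
  interpret finite_measure M by fact
  have s: "summable (\<lambda>n. measure M (A n))"
    by (rule summable_comparison_test'[OF sums_summable[OF geometric_budget[of e]], of 0]) (use assms in auto)
  have "measure M (\<Union>n. A n) \<le> (\<Sum>n. measure M (A n))"
    using assms s by (intro finite_measure_subadditive_countably) auto
  also have "\<dots> \<le> (\<Sum>n. e / 4 * (1/2) ^ n)"
    using assms s sums_summable[OF geometric_budget[of e]] by (intro suminf_le) auto
  also have "\<dots> = e / 2"
    using geometric_budget[of e] by (simp add: sums_iff)
  finally show ?thesis .
qed

lemma finite_measure_incseq_approx:
  assumes "finite_measure M" "\<And>n. A n \<in> sets M" "incseq A" "(e::real) > 0"
  shows "\<exists>n. measure M ((\<Union>i. A i) - A n) < e"
proof -
  interpret finite_measure M by fact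
  have U: "(\<Union>i. A i) \<in> sets M" using assms by auto
  have "(\<lambda>n. measure M (A n)) \<longlonglongrightarrow> measure M (\<Union>i. A i)"
    using assms by (intro finite_Lim_measure_incseq) auto
  then have "eventually (\<lambda>n. \<bar>measure M (A n) - measure M (\<Union>i. A i)\<bar> < e) sequentially"
    using \<open>e > 0\<close> by (auto simp: tendsto_iff dist_real_def)
  then obtain n where n: "\<bar>measure M (A n) - measure M (\<Union>i. A i)\<bar> < e"
    by (auto simp: eventually_sequentially)
  have "measure M ((\<Union>i. A i) - A n) = measure M (\<Union>i. A i) - measure M (A n)"
    using assms U by (intro finite_measure_Diff) auto
  then show ?thesis using n by (intro exI[of _ n]) linarith
qed

text \<open>Approximating from inside and outside at once makes the claim symmetric under
  complements, so it can be proved by induction over the generated sigma-algebra. Metrizability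
  enters in the base case: an open set is an increasing union of closed sets.\<close>

lemma closed_open_approximation:
  assumes metr: "metrizable_space X" and fin: "finite_measure M"
    and sets: "sets M = sets (borel_of X)" and B: "B \<in> sets M" and "(e::real) > 0"
  shows "\<exists>F G. closedin X F \<and> openin X G \<and> F \<subseteq> B \<and> B \<subseteq> G \<and> measure M (G - F) < e"
proof -
  interpret finite_measure M by fact
  have B': "B \<in> sigma_sets (topspace X) {U. openin X U}" using B sets sets_borel_of by blast
  note [simp] = openin_in_sets_borel_of[of X, folded sets] closedin_in_sets_borel_of[of X, folded sets]
  from B' \<open>e > 0\<close> show ?thesis
  proof (induction B arbitrary: e)
    case (Basic U)
    then have U: "openin X U" by simp
    have "fsigma_in X U" by (rule open_imp_fsigma_in[OF metr U])
    then obtain F where F: "\<And>n. closedin X (F n)" "\<And>n. F n \<subseteq> F (Suc n)" "\<Union>(range F) = U"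
      by (auto simp: fsigma_in_ascending)
    obtain n where "measure M ((\<Union>i. F i) - F n) < e"
      using finite_measure_incseq_approx[OF fin _ _ \<open>e > 0\<close>, of F] F by (auto simp: incseq_Suc_iff)
    then show ?case
      using U F by (intro exI[of _ "F n"] exI[of _ U]) auto
  next
    case Empty
    then show ?case by (intro exI[of _ "{}"]) auto
  next
    case (Compl B)
    obtain F G where FG: "closedin X F" "openin X G" "F \<subseteq> B" "B \<subseteq> G" "measure M (G - F) < e"
      using Compl.IH[OF Compl.prems] by blast
    have "(topspace X - F) - (topspace X - G) = G - F"
      using openin_subset[OF FG(2)] by auto
    moreover have "closedin X (topspace X - G)" "openin X (topspace X - F)"
      using FG by auto
    ultimately show ?case
      using FG by (intro exI[of _ "topspace X - G"] exI[of _ "topspace X - F"]) (simp, blast)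
  next
    case (Union B)
    have "\<exists>F G. closedin X F \<and> openin X G \<and> F \<subseteq> B n \<and> B n \<subseteq> G \<and> measure M (G - F) < e / 4 * (1/2) ^ n" for n
      using Union.IH[of "e / 4 * (1/2)^n"] \<open>e > 0\<close> by simp
    then obtain F G where FG: "\<And>n. closedin X (F n)" "\<And>n. openin X (G n)" "\<And>n. F n \<subseteq> B n" "\<And>n. B n \<subseteq> G n"
      "\<And>n. measure M (G n - F n) < e / 4 * (1/2) ^ n"
      by metis
    define F' where "F' n = (\<Union>i\<le>n. F i)" for n
    have F'c: "closedin X (F' n)" for n
      unfolding F'_def using FG by (intro closedin_Union) auto
    have "incseq F'" unfolding F'_def by (fastforce simp: incseq_def)
    \<comment> \<open>A countable union of closed sets need not be closed, so the inner
      approximation is cut off at a finite stage, at the cost of the second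
      \<open>e / 2\<close>.\<close>
    then obtain n where n: "measure M ((\<Union>i. F' i) - F' n) < e / 2"
      using finite_measure_incseq_approx[OF fin, of F' "e/2"] F'c \<open>e > 0\<close> by auto
    have sub: "(\<Union>i. G i) - F' n \<subseteq> (\<Union>i. G i - F i) \<union> ((\<Union>i. F' i) - F' n)"
      unfolding F'_def by blast
    have mF: "F i \<in> sets M" and mG: "G i \<in> sets M" and mF': "F' i \<in> sets M" for i
      using FG(1,2) F'c by auto
    have m: "(\<Union>i. G i - F i) \<in> sets M" "(\<Union>i. F' i) - F' n \<in> sets M"
      using mF mG mF' by auto
    have "measure M ((\<Union>i. G i) - F' n) \<le> measure M ((\<Union>i. G i - F i) \<union> ((\<Union>i. F' i) - F' n))"
      by (intro finite_measure_mono[OF sub] sets.Un m)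
    also have "\<dots> \<le> measure M (\<Union>i. G i - F i) + measure M ((\<Union>i. F' i) - F' n)"
      by (intro measure_Un_le m)
    also have "measure M (\<Union>i. G i - F i) \<le> e / 2"
      using FG by (intro measure_UN_le_geometric[OF fin]) (auto intro: less_imp_le)
    finally have "measure M ((\<Union>i. G i) - F' n) < e" using n by linarith
    moreover have "F' n \<subseteq> (\<Union>i. B i)" "(\<Union>i. B i) \<subseteq> (\<Union>i. G i)"
      unfolding F'_def using FG(3,4) by blast+
    moreover have "openin X (\<Union>i. G i)" using FG(2) by (intro openin_Union) auto
    ultimately show ?case
      by (intro exI[of _ "F' n"] exI[of _ "\<Union>i. G i"] conjI F'c)
  qed
qed

text \<open>For each radius \<open>1 / real (Suc n)\<close>, finitely many closed balls around a
  dense sequence carry almost all mass. The intersection over \<open>n\<close> of these finite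
  unions is closed and totally bounded, hence compact by completeness.\<close>

lemma Ulam_tightness:
  assumes pol: "Polish_space X" and fin: "finite_measure M"
    and sets: "sets M = sets (borel_of X)" and e: "(e::real) > 0"
  shows "\<exists>K. compactin X K \<and> closedin X K \<and> measure M (space M - K) < e"
proof (cases "topspace X = {}")
  case True
  then have "space M = {}" using sets_eq_imp_space_eq[OF sets] by simp
  then show ?thesis using e by (intro exI[of _ "{}"]) auto
next
  case False
  interpret finite_measure M by fact
  have sp: "space M = topspace X" using sets_eq_imp_space_eq[OF sets] by simp
  obtain S d where "Metric_space S d" and mc: "Metric_space.mcomplete S d" and X: "X = Metric_space.mtopology S d"
    using pol unfolding Polish_space_def completely_metrizable_space_def by blast
  interpret Metric_space S d by fact
  obtain C where C: "countable C" "C \<subseteq> topspace X" "X closure_of C = topspace X"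
    using pol unfolding Polish_space_def separable_space_def by blast
  have "C \<noteq> {}" using C False by (metis closure_of_empty)
  define c where "c = from_nat_into C"
  have c: "c i \<in> S" for i
    using from_nat_into[OF \<open>C \<noteq> {}\<close>, of i] C unfolding c_def X by auto
  have dense: "\<exists>i. d (c i) x < r" if "x \<in> S" "r > 0" for x r
  proof -
    have "x \<in> mtopology closure_of C" using that C(3) X by simp
    then obtain y where "y \<in> C" "y \<in> mball x r"
      using \<open>r > 0\<close> unfolding metric_closure_of mem_Collect_eq by meson
    moreover then obtain i where "y = c i"
      using C(1) unfolding c_def by (metis from_nat_into_surj)
    ultimately show ?thesis by (auto simp: commute)
  qed
  define U where "U n k = (\<Union>i\<le>k. mcball (c i) (1 / real (Suc n)))" for n k
  have Uc: "closedin X (U n k)" for n k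
    unfolding U_def X by (intro closedin_Union) auto
  have UN: "(\<Union>k. U n k) = space M" for n
  proof
    show "(\<Union>k. U n k) \<subseteq> space M"
      using Uc closedin_subset sp by blast
    show "space M \<subseteq> (\<Union>k. U n k)"
    proof
      fix x assume "x \<in> space M"
      then have x: "x \<in> S" using sp X by simp
      obtain i where "d (c i) x < 1 / real (Suc n)" using dense[OF x, of "1 / real (Suc n)"] by auto
      then have "x \<in> U n i" unfolding U_def using x c by (force simp: in_mcball)
      then show "x \<in> (\<Union>k. U n k)" by blast
    qed
  qed
  note [simp] = closedin_in_sets_borel_of sets
  have "\<exists>k. measure M (space M - U n k) < e / 4 * (1/2) ^ n" for n
    using finite_measure_incseq_approx[OF fin, of "U n" "e / 4 * (1/2) ^ n"] Uc e
    by (simp add: UN) (force simp: incseq_def U_def)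
  then obtain k where k: "\<And>n. measure M (space M - U n (k n)) < e / 4 * (1/2) ^ n" by metis
  define K where "K = (\<Inter>n. U n (k n))"
  have Kc: "closedin X K" unfolding K_def using Uc by (intro closedin_Inter) auto
  have "mtotally_bounded K"
    unfolding mtotally_bounded_def
  proof (intro allI impI)
    fix r :: real assume "r > 0"
    obtain n where n: "2 / real (Suc n) < r"
      using reals_Archimedean[of "r/2"] \<open>r > 0\<close> by (auto simp: field_simps)
    \<comment> \<open>Total boundedness asks for centres inside \<open>K\<close>. Each ball that
      meets \<open>K\<close> is therefore represented by a point of \<open>K\<close> in it, which
      doubles the radius and explains \<open>2 / real (Suc n) < r\<close>.\<close>
    define I where "I = {i. i \<le> k n \<and> mcball (c i) (1 / real (Suc n)) \<inter> K \<noteq> {}}"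
    have "\<exists>y. y \<in> mcball (c i) (1 / real (Suc n)) \<inter> K" if "i \<in> I" for i
      using that unfolding I_def by auto
    then obtain y where y: "\<And>i. i \<in> I \<Longrightarrow> y i \<in> mcball (c i) (1 / real (Suc n)) \<inter> K"
      by metis
    have "x \<in> (\<Union>z\<in>y ` I. mball z r)" if x: "x \<in> K" for x
    proof -
      obtain i where i: "i \<le> k n" "x \<in> mcball (c i) (1 / real (Suc n))"
        using x unfolding K_def U_def by blast
      then have iI: "i \<in> I" using x unfolding I_def by blast
      have mem: "y i \<in> S" "x \<in> S" "c i \<in> S" using y[OF iI] i by auto
      have "d (y i) x \<le> d (y i) (c i) + d (c i) x" using mem by (intro triangle) 
      also have "\<dots> \<le> 1 / real (Suc n) + 1 / real (Suc n)"
        using y[OF iI] i by (intro add_mono) (auto simp: commute)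
      also have "\<dots> < r" using n by simp
      finally show ?thesis using mem iI by auto
    qed
    then have "K \<subseteq> (\<Union>z\<in>y ` I. mball z r)" by blast
    moreover have "finite (y ` I)" unfolding I_def by simp
    moreover have "y ` I \<subseteq> K" using y by blast
    ultimately show "\<exists>F. finite F \<and> F \<subseteq> K \<and> K \<subseteq> (\<Union>x\<in>F. mball x r)" by blast
  qed
  then have "compactin X (X closure_of K)"
    using mtotally_bounded_eq_compact_closure_of[OF mc] X by simp
  then have comp: "compactin X K" using Kc by (simp add: closure_of_closedin)
  have eq: "space M - K = (\<Union>n. space M - U n (k n))" unfolding K_def by auto
  have "measure M (space M - K) \<le> e / 2"
    unfolding eq
  proof (rule measure_UN_le_geometric[OF fin])
    show "space M - U n (k n) \<in> sets M" for n
      using Uc by (intro sets.compl_sets) simp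
  next
    show "measure M (space M - U n (k n)) \<le> e / 4 * (1/2) ^ n" for n
      using k[of n] by simp
  qed
  then show ?thesis using comp Kc e by (intro exI[of _ K]) auto
qed

text \<open>Together with \<open>radon_prob_approx\<close>, this trades the supremum over compact
  sets in \<open>ennreal\<close> for an error bound in the reals, the form in which regularity is
  used below.\<close>

lemma radon_probI:
  assumes "prob_space M" "sets M = sets (borel_of T)"
    and approx: "\<And>B e. B \<in> sets M \<Longrightarrow> (e::real) > 0 \<Longrightarrow>
      \<exists>K. compactin T K \<and> K \<subseteq> B \<and> K \<in> sets M \<and> measure M (B - K) < e"
  shows "radon_prob T M"
  unfolding radon_prob_def
proof (intro conjI ballI)
  interpret prob_space M by fact
  fix B assume B: "B \<in> sets M"
  show "emeasure M B = (SUP K\<in>{K. compactin T K \<and> K \<subseteq> B \<and> K \<in> sets M}. emeasure M K)"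
  proof (rule ennreal_approx_SUP)
    show "emeasure M K \<le> emeasure M B" if "K \<in> {K. compactin T K \<and> K \<subseteq> B \<and> K \<in> sets M}" for K
      using that B by (intro emeasure_mono) auto
    fix e :: real assume "e > 0"
    then obtain K where K: "compactin T K" "K \<subseteq> B" "K \<in> sets M" "measure M (B - K) < e"
      using approx[OF B] by blast
    then have "measure M B \<le> measure M K + e"
      using B finite_measure_Diff[of B K] by auto
    then show "\<exists>K\<in>{K. compactin T K \<and> K \<subseteq> B \<and> K \<in> sets M}. emeasure M B \<le> emeasure M K + ennreal e"
      using K \<open>e > 0\<close> by (intro bexI[of _ K]) (auto simp: emeasure_eq_measure simp flip: ennreal_plus)
  qed
qed (fact assms(1), fact assms(2))

lemma radon_prob_approx:
  assumes "radon_prob T M" "B \<in> sets M" "(e::real) > 0"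
  shows "\<exists>K. compactin T K \<and> K \<subseteq> B \<and> K \<in> sets M \<and> measure M (B - K) < e"
proof -
  interpret prob_space M using assms by (simp add: radon_prob_def)
  have eq: "emeasure M B = (SUP K\<in>{K. compactin T K \<and> K \<subseteq> B \<and> K \<in> sets M}. emeasure M K)"
    using assms by (auto simp: radon_prob_def)
  obtain K where K: "compactin T K" "K \<subseteq> B" "K \<in> sets M" "emeasure M B < emeasure M K + ennreal e"
    using SUP_approx_ennreal[OF _ _ eq, of e] assms(3) by auto
  then have "measure M B < measure M K + e"
    using assms(3) by (simp add: emeasure_eq_measure ennreal_less_iff flip: ennreal_plus)
  then show ?thesis
    using K finite_measure_Diff[of B K] assms(2) by (intro exI[of _ K]) auto
qed

text \<open>A closed inner approximation of \<open>B\<close> intersected with a compact set of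
  almost full measure is compact, and the two errors add.\<close>

lemma Polish_imp_radon_prob:
  assumes pol: "Polish_space X" and prob: "prob_space M" and sets: "sets M = sets (borel_of X)"
  shows "radon_prob X M"
proof (rule radon_probI[OF prob sets])
  interpret prob_space M by fact
  fix B and e :: real assume B: "B \<in> sets M" and e: "e > 0"
  have metr: "metrizable_space X"
    using pol by (simp add: Polish_space_def completely_metrizable_imp_metrizable_space)
  obtain K where K: "compactin X K" "closedin X K" "measure M (space M - K) < e / 2"
    using Ulam_tightness[OF pol finite_measure_axioms sets, of "e/2"] e by auto
  obtain F G where FG: "closedin X F" "openin X G" "F \<subseteq> B" "B \<subseteq> G" "measure M (G - F) < e / 2"
    using closed_open_approximation[OF metr finite_measure_axioms sets B, of "e/2"] e by auto
  note [simp, intro] = openin_in_sets_borel_of[of X, folded sets] closedin_in_sets_borel_of[of X, folded sets]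
  have "measure M (B - K \<inter> F) \<le> measure M ((space M - K) \<union> (G - F))"
    using FG K B sets.sets_into_space[OF B] by (intro finite_measure_mono) auto
  also have "\<dots> \<le> measure M (space M - K) + measure M (G - F)"
    using FG K by (intro measure_Un_le) auto
  also have "\<dots> < e" using K FG by simp
  finally have "measure M (B - K \<inter> F) < e" .
  moreover have "compactin X (K \<inter> F)"
    using K FG by (intro compact_Int_closedin)
  moreover have "K \<inter> F \<in> sets M" using K FG by auto
  ultimately show "\<exists>K. compactin X K \<and> K \<subseteq> B \<and> K \<in> sets M \<and> measure M (B - K) < e"
    using FG by (intro exI[of _ "K \<inter> F"]) auto
qed

section \<open>Lusin's theorem and images of Radon laws\<close>

text \<open>Each subbasic preimage \<open>D n\<close> and its complement are approximated from
  inside by compact sets \<open>K1 n\<close> and \<open>K2 n\<close>. On a set contained in every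
  \<open>K1 n \<union> K2 n\<close> the preimage becomes relatively open. The target enters only
  through a countable subbase, so no metric on it is involved.\<close>

lemma Lusin_compact:
  assumes rad: "radon_prob X M" and Haus: "Hausdorff_space X"
    and S: "countable S" "\<And>s. s \<in> S \<Longrightarrow> T -` s \<inter> topspace X \<in> sets M" "T \<in> topspace X \<rightarrow> \<Union>S"
    and B: "B \<in> sets M" and e: "(e::real) > 0"
  shows "\<exists>K. compactin X K \<and> K \<subseteq> B \<and> K \<in> sets M \<and> measure M (B - K) < e \<and>
    continuous_map (subtopology X K) (topology_generated_by S) T"
proof -
  interpret prob_space M using rad by (simp add: radon_prob_def)
  have sets: "sets M = sets (borel_of X)" using rad by (simp add: radon_prob_def)
  have sp: "space M = topspace X" using sets_eq_imp_space_eq[OF sets] by simp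
  note compl = closedin_in_sets_borel_of[OF compactin_imp_closedin[OF Haus], folded sets]
  \<comment> \<open>The empty set is added so that there is something to enumerate even if
    \<open>S\<close> is empty; its preimage is empty and hence measurable.\<close>
  define s where "s = from_nat_into (insert {} S)"
  have s_range: "range s = insert {} S"
    unfolding s_def using S(1) by (intro range_from_nat_into) auto
  define D where "D n = T -` s n \<inter> topspace X" for n
  have D: "D n \<in> sets M" for n
  proof -
    have "s n \<in> insert {} S" using s_range by blast
    then show ?thesis using S(2) unfolding D_def by auto
  qed
  \<comment> \<open>Two approximations are made for each \<open>n\<close>, each with half of the
    budget \<open>e / 4 * (1/2) ^ n\<close>.\<close>
  have e8: "e / 8 * (1/2) ^ n > 0" for n using e by simp
  have "\<exists>K. compactin X K \<and> K \<subseteq> D n \<and> K \<in> sets M \<and> measure M (D n - K) < e / 8 * (1/2) ^ n" for n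
    by (rule radon_prob_approx[OF rad D e8])
  then obtain K1 where K1: "\<And>n. compactin X (K1 n)" "\<And>n. K1 n \<subseteq> D n" "\<And>n. K1 n \<in> sets M"
      "\<And>n. measure M (D n - K1 n) < e / 8 * (1/2) ^ n"
    by metis
  have D': "space M - D n \<in> sets M" for n using D by blast
  have "\<exists>K. compactin X K \<and> K \<subseteq> space M - D n \<and> K \<in> sets M \<and> measure M ((space M - D n) - K) < e / 8 * (1/2) ^ n" for n
    by (rule radon_prob_approx[OF rad D' e8])
  then obtain K2 where K2: "\<And>n. compactin X (K2 n)" "\<And>n. K2 n \<subseteq> space M - D n" "\<And>n. K2 n \<in> sets M"
      "\<And>n. measure M ((space M - D n) - K2 n) < e / 8 * (1/2) ^ n"
    by metis
  obtain K0 where K0: "compactin X K0" "K0 \<subseteq> B" "K0 \<in> sets M" "measure M (B - K0) < e / 2"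
    using radon_prob_approx[OF rad B, of "e/2"] e by auto
  define K where "K = K0 \<inter> (\<Inter>n. K1 n \<union> K2 n)"
  define R where "R n = (D n - K1 n) \<union> ((space M - D n) - K2 n)" for n
  have R: "R n \<in> sets M" for n unfolding R_def using D D' K1 K2 by auto
  have cl: "closedin X (\<Inter>n. K1 n \<union> K2 n)"
    using K1(1) K2(1) by (intro closedin_Inter) (auto intro!: compactin_imp_closedin[OF Haus] compactin_Un)
  have K: "compactin X K" unfolding K_def by (rule compact_Int_closedin[OF K0(1) cl])
  have "measure M (R n) \<le> e / 4 * (1/2) ^ n" for n
  proof -
    have "measure M (R n) \<le> measure M (D n - K1 n) + measure M ((space M - D n) - K2 n)"
      unfolding R_def using D D' K1 K2 by (intro measure_Un_le) auto
    also have "\<dots> \<le> e / 8 * (1/2) ^ n + e / 8 * (1/2) ^ n"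
      using K1(4)[of n] K2(4)[of n] by linarith
    finally show ?thesis by (simp add: field_simps)
  qed
  then have UR: "measure M (\<Union>n. R n) \<le> e / 2"
    using R by (intro measure_UN_le_geometric finite_measure_axioms)
  have sub: "B - K \<subseteq> (B - K0) \<union> (\<Union>n. R n)"
    using sets.sets_into_space[OF B] unfolding K_def R_def by blast
  have "measure M (B - K) \<le> measure M ((B - K0) \<union> (\<Union>n. R n))"
    using B K0 R by (intro finite_measure_mono[OF sub]) auto
  also have "\<dots> \<le> measure M (B - K0) + measure M (\<Union>n. R n)"
    using B K0 R by (intro measure_Un_le) auto
  also have "\<dots> < e" using K0 UR by linarith
  finally have small: "measure M (B - K) < e" .
  have "continuous_map (subtopology X K) (topology_generated_by S) T"
  proof (rule continuous_on_generated_topo)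
    show "T ` topspace (subtopology X K) \<subseteq> \<Union>S" using S(3) by auto
    fix U assume "U \<in> S"
    then obtain n where n: "U = s n" using s_range by blast
    \<comment> \<open>Inside \<open>K\<close>, lying in \<open>D n\<close> is the same as avoiding
      \<open>K2 n\<close>, and \<open>K2 n\<close> is closed because \<open>X\<close> is
      Hausdorff.\<close>
    have "T -` U \<inter> topspace (subtopology X K) = (topspace X - K2 n) \<inter> K"
      using K1(2)[of n] K2(2)[of n] unfolding n K_def D_def by (auto simp: sp)
    moreover have "openin X (topspace X - K2 n)"
      using compactin_imp_closedin[OF Haus K2(1)] by blast
    ultimately show "openin (subtopology X K) (T -` U \<inter> topspace (subtopology X K))"
      by (metis openin_subtopology)
  qed
  then show ?thesis using K small K0(2) compl[OF K] by (intro exI[of _ K]) (auto simp: K_def)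
qed

lemma compactin_continuous_subtopology_image:
  assumes "compactin X K" "continuous_map (subtopology X K) Y f"
  shows "compactin Y (f ` K)"
  using image_compactin[OF _ assms(2), of K] assms(1) by (simp add: compactin_subtopology)

lemma radon_prob_distr:
  assumes rad: "radon_prob X M" and Haus: "Hausdorff_space X"
    and Y: "countable S" "Y = topology_generated_by S" "Hausdorff_space Y"
    and T: "T \<in> M \<rightarrow>\<^sub>M borel_of Y"
  shows "radon_prob Y (distr M (borel_of Y) T)"
proof (rule radon_probI)
  interpret prob_space M using rad by (simp add: radon_prob_def)
  have sets: "sets M = sets (borel_of X)" using rad by (simp add: radon_prob_def)
  have sp: "space M = topspace X" using sets_eq_imp_space_eq[OF sets] by simp
  show "prob_space (distr M (borel_of Y) T)" by (rule prob_space_distr[OF T])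
  fix B and e :: real assume B: "B \<in> sets (distr M (borel_of Y) T)" and e: "e > 0"
  have B': "T -` B \<inter> space M \<in> sets M" using measurable_sets[OF T] B by simp
  have "T \<in> topspace X \<rightarrow> \<Union>S"
    using measurable_space[OF T] Y(2) sp by auto
  moreover have "T -` s \<inter> topspace X \<in> sets M" if "s \<in> S" for s
  proof -
    have "s \<in> sets (borel_of Y)"
      unfolding Y(2) by (intro openin_in_sets_borel_of topology_generated_by_Basis that)
    then show ?thesis using measurable_sets[OF T] sp by metis
  qed
  ultimately obtain K where K: "compactin X K" "K \<subseteq> T -` B \<inter> space M" "K \<in> sets M"
      "measure M (T -` B \<inter> space M - K) < e" "continuous_map (subtopology X K) Y T"
    using Lusin_compact[OF rad Haus Y(1) _ _ B' e] unfolding Y(2) by metis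
  have TK: "compactin Y (T ` K)" by (rule compactin_continuous_subtopology_image[OF K(1,5)])
  then have TK': "T ` K \<in> sets (borel_of Y)"
    using Y(3) by (intro closedin_in_sets_borel_of compactin_imp_closedin)
  have "measure (distr M (borel_of Y) T) (B - T ` K) = measure M (T -` (B - T ` K) \<inter> space M)"
    using B TK' by (intro measure_distr T) auto
  also have "\<dots> \<le> measure M (T -` B \<inter> space M - K)"
    using B' K(3) by (intro finite_measure_mono) auto
  also have "\<dots> < e" by fact
  finally show "\<exists>K. compactin Y K \<and> K \<subseteq> B \<and> K \<in> sets (distr M (borel_of Y) T) \<and>
      measure (distr M (borel_of Y) T) (B - K) < e"
    using TK TK' K(2) by (intro exI[of _ "T ` K"]) auto
qed simp

text \<open>Finite intersections of a countable subbase form a countable base, so arbitrary open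
  sets already lie in the sigma-algebra of the subbase.\<close>

lemma sets_borel_of_topology_generated_by:
  assumes "countable S"
  shows "sets (borel_of (topology_generated_by S)) = sigma_sets (\<Union>S) S"
proof
  \<comment> \<open>\<open>F \<noteq> {}\<close> is required because \<open>\<Inter>{}\<close> is
    the whole type, whereas the carrier of the topology is \<open>\<Union>S\<close>.\<close>
  let ?\<B> = "Inter ` {F. finite F \<and> F \<subseteq> S \<and> F \<noteq> {}}"
  show "sets (borel_of (topology_generated_by S)) \<subseteq> sigma_sets (\<Union>S) S"
  proof (rule sets_borel_of_subset_of_base)
    have "countable {F. finite F \<and> F \<subseteq> S}" by (rule countable_Collect_finite_subset[OF assms])
    then show "countable ?\<B>" by (intro countable_image) (auto intro: countable_subset[rotated])
    have S: "S \<subseteq> Pow (\<Union>S)" by blast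
    show sig: "sigma_algebra (topspace (topology_generated_by S)) (sigma_sets (\<Union>S) S)"
      by (simp add: sigma_algebra_sigma_sets[OF S])
    show "?\<B> \<subseteq> sigma_sets (\<Union>S) S"
    proof
      fix V assume "V \<in> ?\<B>"
      then obtain F where F: "finite F" "F \<subseteq> S" "F \<noteq> {}" "V = \<Inter>F" by auto
      interpret sigma_algebra "\<Union>S" "sigma_sets (\<Union>S) S" by (rule sigma_algebra_sigma_sets[OF S])
      show "V \<in> sigma_sets (\<Union>S) S"
        using finite_INT[OF F(1,3), of "\<lambda>x. x"] F(2,4) by auto
    qed
    fix W x assume W: "openin (topology_generated_by S) W" and x: "x \<in> W"
    have "generate_topology_on S W" using W openin_topology_generated_by by blast
    then show "\<exists>V\<in>?\<B>. x \<in> V \<and> V \<subseteq> W" using x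
    proof (induction arbitrary: x)
      case (Int a b)
      then obtain F G where "finite F" "F \<subseteq> S" "F \<noteq> {}" "x \<in> \<Inter>F" "\<Inter>F \<subseteq> a"
          "finite G" "G \<subseteq> S" "G \<noteq> {}" "x \<in> \<Inter>G" "\<Inter>G \<subseteq> b"
        by (smt (verit) IntE image_iff mem_Collect_eq)
      then have "\<Inter>(F \<union> G) \<in> ?\<B>" "x \<in> \<Inter>(F \<union> G)" "\<Inter>(F \<union> G) \<subseteq> a \<inter> b"
        by (auto intro!: imageI)
      then show ?case by blast
    next
      case (UN K)
      then show ?case by (meson Union_iff Union_upper subset_trans)
    next
      case (Basis s)
      then show ?case by (intro bexI[of _ "\<Inter>{s}"]) (auto intro!: imageI)
    qed simp
  qed
  show "sigma_sets (\<Union>S) S \<subseteq> sets (borel_of (topology_generated_by S))"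
    using sets.sigma_sets_subset[of S "borel_of (topology_generated_by S)"]
    by (simp add: subset_iff openin_in_sets_borel_of topology_generated_by_Basis)
qed

subsection \<open>The tight topology\<close>

text \<open>On a Polish space the Radon condition is automatic, so the kernel calculus of
  \<open>prob_algebra\<close>, in particular \<open>bind\<close>, applies to
  \<open>M1 X\<close>.\<close>

lemma M1_eq_space_prob_algebra:
  assumes "Polish_space X"
  shows "M1 X = space (prob_algebra (borel_of X))"
  unfolding M1_def space_prob_algebra
  using Polish_imp_radon_prob[OF assms] by (auto simp: radon_prob_def)

lemma M1_D:
  assumes "P \<in> M1 X"
  shows "prob_space P" "sets P = sets (borel_of X)" "space P = topspace X"
proof -
  show "prob_space P" and s: "sets P = sets (borel_of X)" using assms by (auto simp: M1_def radon_prob_def)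
  show "space P = topspace X" using sets_eq_imp_space_eq[OF s] by simp
qed

lemma topspace_tight_top [simp]: "topspace (tight_top X) = M1 X"
  unfolding tight_top_def by auto

lemma bounded_continuous_integrable:
  assumes "bounded_continuous X f" "P \<in> M1 X"
  shows "integrable P f"
proof -
  interpret prob_space P using assms M1_D by blast
  obtain B where B: "\<And>x. x \<in> topspace X \<Longrightarrow> \<bar>f x\<bar> \<le> B"
    using assms(1) by (auto simp: bounded_continuous_def)
  have "f \<in> borel_measurable (borel_of X)"
    using continuous_map_measurable[of X euclideanreal f] assms(1) by (simp add: bounded_continuous_def)
  then have "f \<in> borel_measurable P"
    using M1_D(2)[OF assms(2)] by (simp cong: measurable_cong_sets)
  then show ?thesis
    using B M1_D(3)[OF assms(2)] by (intro integrable_const_bound[of _ B]) auto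
qed

lemma openin_tight_top_integral:
  "bounded_continuous X f \<Longrightarrow> open V \<Longrightarrow> openin (tight_top X) {P \<in> M1 X. integral\<^sup>L P f \<in> V}"
  unfolding tight_top_def by (rule topology_generated_by_Basis) blast

text \<open>\<open>U\<close> is an increasing union of closed sets \<open>F n\<close>; Urysohn
  functions that are 1 on \<open>F n\<close> and 0 off \<open>U\<close> are eventually exact at
  every point.\<close>

lemma open_indicator_approximation:
  assumes metr: "metrizable_space X" and U: "openin X U"
  shows "\<exists>f. (\<forall>n. bounded_continuous X (f n)) \<and>
    (\<forall>n. \<forall>x\<in>topspace X. 0 \<le> f n x \<and> f n x \<le> indicat_real U x) \<and>
    (\<forall>x\<in>topspace X. (\<lambda>n. f n x) \<longlonglongrightarrow> indicat_real U x)"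
proof -
  have "fsigma_in X U" by (rule open_imp_fsigma_in[OF metr U])
  then obtain F where F: "\<And>n. closedin X (F n)" "\<And>n. F n \<subseteq> F (Suc n)" "\<Union>(range F) = U"
    by (auto simp: fsigma_in_ascending)
  have incF: "F m \<subseteq> F n" if "m \<le> n" for m n using F(2) that by (rule lift_Suc_mono_le)
  have "\<exists>f. continuous_map X (top_of_set {0..1}) f \<and> f ` (topspace X - U) \<subseteq> {0::real} \<and> f ` F n \<subseteq> {1}" for n
  proof -
    have "disjnt (topspace X - U) (F n)" using F(3) by (auto simp: disjnt_def)
    then show ?thesis
      using Urysohn_lemma[OF metrizable_imp_normal_space[OF metr], of "topspace X - U" "F n" "0::real" 1] U F(1)
      by (metis openin_closedin_eq zero_le_one)
  qed
  then obtain f where f: "\<And>n. continuous_map X (top_of_set {0..1}) (f n)"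
      "\<And>n. f n ` (topspace X - U) \<subseteq> {0::real}" "\<And>n. f n ` F n \<subseteq> {1}" by metis
  have cont: "continuous_map X euclideanreal (f n)" and f01: "x \<in> topspace X \<Longrightarrow> f n x \<in> {0..1}" for n x
    using f(1)[of n] by (auto simp: continuous_map_in_subtopology)
  have "bounded_continuous X (f n)" for n
    unfolding bounded_continuous_def using cont f01 by (intro conjI exI[of _ 1]) auto
  moreover have "0 \<le> f n x \<and> f n x \<le> indicat_real U x" if "x \<in> topspace X" for n x
    using f01[OF that, of n] f(2)[of n] that by (auto simp: indicator_def)
  moreover have "(\<lambda>n. f n x) \<longlonglongrightarrow> indicat_real U x" if x: "x \<in> topspace X" for x
  proof (cases "x \<in> U")
    case True
    then obtain m where "x \<in> F m" using F(3) by blast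
    then have "f n x = 1" if "n \<ge> m" for n using incF[OF that] f(3)[of n] by blast
    then have "eventually (\<lambda>n. f n x = indicat_real U x) sequentially"
      unfolding eventually_sequentially using True by auto
    then show ?thesis by (rule tendsto_eventually)
  next
    case False
    then have "f n x = 0" for n using f(2)[of n] x by blast
    with False show ?thesis by simp
  qed
  ultimately show ?thesis by blast
qed

lemma integral_indicator_approximation:
  assumes P: "P \<in> M1 X" and U: "openin X U"
    and f: "\<And>n. bounded_continuous X (f n)"
      "\<And>n x. x \<in> topspace X \<Longrightarrow> 0 \<le> f n x \<and> f n x \<le> indicat_real U x"
      "\<And>x. x \<in> topspace X \<Longrightarrow> (\<lambda>n. f n x) \<longlonglongrightarrow> indicat_real U x"
  shows "(\<lambda>n. integral\<^sup>L P (f n)) \<longlonglongrightarrow> measure P U" "integral\<^sup>L P (f n) \<le> measure P U"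
proof -
  interpret prob_space P using P M1_D by blast
  note sp = M1_D(3)[OF P]
  have U': "U \<in> sets P" using openin_in_sets_borel_of[OF U] M1_D(2)[OF P] by simp
  have int: "integrable P (f n)" for n by (rule bounded_continuous_integrable[OF f(1) P])
  have "(\<lambda>n. integral\<^sup>L P (f n)) \<longlonglongrightarrow> integral\<^sup>L P (indicat_real U)"
  proof (rule integral_dominated_convergence[where w = "\<lambda>_. 1"])
    show "AE x in P. norm (f n x) \<le> 1" for n
    proof (rule AE_I2)
      fix x assume "x \<in> space P"
      then have "0 \<le> f n x" "f n x \<le> indicat_real U x" using f(2) sp by auto
      then show "norm (f n x) \<le> 1" by (cases "x \<in> U") auto
    qed
  qed (use U' int f(3) sp in \<open>auto intro!: AE_I2\<close>)
  then show "(\<lambda>n. integral\<^sup>L P (f n)) \<longlonglongrightarrow> measure P U" using U' by simp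
  have "integral\<^sup>L P (f n) \<le> integral\<^sup>L P (indicat_real U)"
    using int U' f(2) sp openin_subset[OF U]
    by (intro integral_mono) (auto simp: integrable_indicator_iff emeasure_eq_measure Int_absorb2)
  then show "integral\<^sup>L P (f n) \<le> measure P U" using U' by simp
qed

text \<open>The open-set half of the portmanteau theorem: \<open>measure P U\<close> is a supremum
  of integrals of bounded continuous functions, hence lower semicontinuous in
  \<open>P\<close>.\<close>

lemma openin_tight_top_measure_greater:
  assumes metr: "metrizable_space X" and U: "openin X U"
  shows "openin (tight_top X) {P \<in> M1 X. measure P U > r}"
proof -
  obtain f where f: "\<And>n. bounded_continuous X (f n)"
      "\<And>n x. x \<in> topspace X \<Longrightarrow> 0 \<le> f n x \<and> f n x \<le> indicat_real U x"
      "\<And>x. x \<in> topspace X \<Longrightarrow> (\<lambda>n. f n x) \<longlonglongrightarrow> indicat_real U x"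
    using open_indicator_approximation[OF metr U] by metis
  have "measure P U > r \<longleftrightarrow> (\<exists>n. integral\<^sup>L P (f n) \<in> {r<..})" if P: "P \<in> M1 X" for P
  proof
    assume "measure P U > r"
    then have "eventually (\<lambda>n. integral\<^sup>L P (f n) > r) sequentially"
      using integral_indicator_approximation(1)[OF P U f] order_tendstoD(1) by blast
    then show "\<exists>n. integral\<^sup>L P (f n) \<in> {r<..}" by (auto simp: eventually_sequentially)
  next
    assume "\<exists>n. integral\<^sup>L P (f n) \<in> {r<..}"
    then obtain n where "integral\<^sup>L P (f n) > r" by auto
    also have "integral\<^sup>L P (f n) \<le> measure P U"
      by (rule integral_indicator_approximation(2)[OF P U f])
    finally show "measure P U > r" .
  qed
  then have "{P \<in> M1 X. measure P U > r} = (\<Union>n. {P \<in> M1 X. integral\<^sup>L P (f n) \<in> {r<..}})"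
    by blast
  also have "openin (tight_top X) \<dots>"
    by (intro openin_Union) (use openin_tight_top_integral[OF f(1), of "{r<..}"] in auto)
  finally show ?thesis .
qed

text \<open>Integrals of bounded continuous functions determine the measures of open sets, and the
  open sets are an intersection-stable generator of the Borel sets.\<close>

lemma Hausdorff_tight_top:
  assumes metr: "metrizable_space X"
  shows "Hausdorff_space (tight_top X)"
  unfolding Hausdorff_space_def
proof (intro allI impI)
  fix P Q assume "P \<in> topspace (tight_top X) \<and> Q \<in> topspace (tight_top X) \<and> P \<noteq> Q"
  then have P: "P \<in> M1 X" and Q: "Q \<in> M1 X" and neq: "P \<noteq> Q" by auto
  interpret P: prob_space P using P M1_D by blast
  interpret Q: prob_space Q using Q M1_D by blast
  have "\<exists>f. bounded_continuous X f \<and> integral\<^sup>L P f \<noteq> integral\<^sup>L Q f"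
  proof (rule ccontr)
    assume "\<not> ?thesis"
    then have eq: "integral\<^sup>L P f = integral\<^sup>L Q f" if "bounded_continuous X f" for f using that by blast
    have eqU: "measure P U = measure Q U" if U: "openin X U" for U
    proof -
      obtain f where f: "\<And>n. bounded_continuous X (f n)"
          "\<And>n x. x \<in> topspace X \<Longrightarrow> 0 \<le> f n x \<and> f n x \<le> indicat_real U x"
          "\<And>x. x \<in> topspace X \<Longrightarrow> (\<lambda>n. f n x) \<longlonglongrightarrow> indicat_real U x"
        using open_indicator_approximation[OF metr U] by metis
      show ?thesis
        using integral_indicator_approximation(1)[OF P U f] integral_indicator_approximation(1)[OF Q U f]
        unfolding eq[OF f(1)] by (rule LIMSEQ_unique)
    qed
    have "P = Q"
    proof (rule measure_eqI_generator_eq[where E = "{U. openin X U}" and \<Omega> = "topspace X" and A = "\<lambda>_. topspace X"])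
      show "Int_stable {U. openin X U}" by (auto intro!: Int_stableI)
      show "{U. openin X U} \<subseteq> Pow (topspace X)" using openin_subset by fast
      show "emeasure P U = emeasure Q U" if "U \<in> {U. openin X U}" for U
        using eqU that by (simp add: P.emeasure_eq_measure Q.emeasure_eq_measure)
      show "sets P = sigma_sets (topspace X) {U. openin X U}" "sets Q = sigma_sets (topspace X) {U. openin X U}"
        using M1_D(2)[OF P] M1_D(2)[OF Q] sets_borel_of by simp_all
    qed (auto simp: P.emeasure_eq_measure)
    with neq show False ..
  qed
  then obtain f where f: "bounded_continuous X f" "integral\<^sup>L P f \<noteq> integral\<^sup>L Q f" by blast
  then obtain V W where VW: "open V" "open W" "integral\<^sup>L P f \<in> V" "integral\<^sup>L Q f \<in> W" "V \<inter> W = {}"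
    using hausdorff[OF f(2)] by metis
  show "\<exists>U V. openin (tight_top X) U \<and> openin (tight_top X) V \<and> P \<in> U \<and> Q \<in> V \<and> disjnt U V"
    using openin_tight_top_integral[OF f(1) VW(1)] openin_tight_top_integral[OF f(1) VW(2)] VW P Q
    by (intro exI[of _ "{P \<in> M1 X. integral\<^sup>L P f \<in> V}"] exI[of _ "{P \<in> M1 X. integral\<^sup>L P f \<in> W}"])
      (auto simp: disjnt_def)
qed

section \<open>A countable subbase of the tight topology\<close>

text \<open>By continuity from below, finitely many basis sets inside \<open>E\<close> exhaust its
  mass up to \<open>e\<close>. This lets countably many unions stand in for all open sets.\<close>

lemma countable_basis_inner_approximation:
  assumes basis: "countable_basis X \<U>" and P: "finite_measure P" "sets P = sets (borel_of X)"
    and E: "openin X E" and e: "(e::real) > 0"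
  shows "\<exists>\<V>. finite \<V> \<and> \<V> \<subseteq> \<U> \<and> \<Union>\<V> \<subseteq> E \<and> measure P E < measure P (\<Union>\<V>) + e"
proof -
  interpret finite_measure P by fact
  \<comment> \<open>The empty set guarantees a non-empty family to enumerate; it is discarded at the
    end, since it need not belong to \<open>\<U>\<close>.\<close>
  define \<W> where "\<W> = insert {} {V\<in>\<U>. V \<subseteq> E}"
  have "countable \<W>" using basis unfolding \<W>_def countable_basis_def by (auto intro: countable_subset)
  have \<W>: "\<W> \<noteq> {}" unfolding \<W>_def by simp
  define w where "w = from_nat_into \<W>"
  have w: "range w = \<W>" unfolding w_def by (rule range_from_nat_into[OF \<W> \<open>countable \<W>\<close>])
  have wo: "openin X (w n)" for n
  proof -
    have "w n \<in> \<W>" using w by blast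
    then show ?thesis using basis unfolding \<W>_def countable_basis_def by auto
  qed
  have UE: "(\<Union>n. w n) = E"
  proof
    show "(\<Union>n. w n) \<subseteq> E" unfolding w \<W>_def by blast
    show "E \<subseteq> (\<Union>n. w n)"
    proof
      fix x assume "x \<in> E"
      then obtain V where "V \<in> \<U>" "x \<in> V" "V \<subseteq> E" using basis E unfolding countable_basis_def by meson
      then show "x \<in> (\<Union>n. w n)" unfolding w \<W>_def by blast
    qed
  qed
  define A where "A n = (\<Union>i\<le>n. w i)" for n
  have A: "A n \<in> sets P" for n
    unfolding A_def P(2) using wo by (intro openin_in_sets_borel_of openin_Union) auto
  have "incseq A" unfolding A_def by (fastforce simp: incseq_def)
  moreover have "(\<Union>n. A n) = E" unfolding A_def UE[symmetric] by blast
  ultimately obtain n where n: "measure P (E - A n) < e"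
    using finite_measure_incseq_approx[OF P(1), of A e] A e by auto
  have "A n \<subseteq> E" unfolding A_def UE[symmetric] by blast
  moreover have "E \<in> sets P" unfolding P(2) by (rule openin_in_sets_borel_of[OF E])
  ultimately have "measure P E < measure P (A n) + e"
    using n finite_measure_Diff[of E "A n"] A by auto
  moreover have "A n = \<Union>(w ` {..n} - {{}})" unfolding A_def by auto
  moreover have "w ` {..n} - {{}} \<subseteq> \<U>" using w unfolding \<W>_def by blast
  ultimately show ?thesis
    using \<open>A n \<subseteq> E\<close> by (intro exI[of _ "w ` {..n} - {{}}"]) auto
qed

text \<open>The strict inequality makes the count \<open>nat \<lceil>y\<rceil> - 1\<close>;
  truncated subtraction gives the right value 0 for \<open>y = 0\<close>. The bound
  \<open>y \<le> real n\<close> ensures that \<open>{1..n}\<close> misses no such index.\<close>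

lemma card_below_real:
  assumes "0 \<le> y" "y \<le> real n"
  shows "real (card {i\<in>{1..n}. real i < y}) \<le> y" "y \<le> real (card {i\<in>{1..n}. real i < y}) + 1"
proof -
  have eq: "{i\<in>{1..n}. real i < y} = {1..<nat \<lceil>y\<rceil>}"
  proof (intro set_eqI iffI)
    fix i assume "i \<in> {1..<nat \<lceil>y\<rceil>}"
    then have "1 \<le> i" "int i < \<lceil>y\<rceil>" by auto
    then have "real i < y" by (simp add: less_ceiling_iff)
    with assms \<open>1 \<le> i\<close> show "i \<in> {i\<in>{1..n}. real i < y}" by simp
  next
    fix i assume "i \<in> {i\<in>{1..n}. real i < y}"
    then have "1 \<le> i" "int i < \<lceil>y\<rceil>" by (auto simp: less_ceiling_iff)
    then show "i \<in> {1..<nat \<lceil>y\<rceil>}" by auto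
  qed
  have card: "card {i\<in>{1..n}. real i < y} = nat \<lceil>y\<rceil> - 1" unfolding eq by simp
  show "real (card {i\<in>{1..n}. real i < y}) \<le> y"
    unfolding card using assms(1) by linarith
  show "y \<le> real (card {i\<in>{1..n}. real i < y}) + 1"
    unfolding card by linarith
qed

lemma superlevel_average_bounds:
  fixes t :: real
  assumes "0 \<le> t" "t \<le> 1" "0 < n"
  shows "(\<Sum>i\<in>{1..n}. of_bool (real i / real n < t)) / real n \<le> t"
    "t \<le> (\<Sum>i\<in>{1..n}. of_bool (real i / real n < t)) / real n + 1 / real n"
proof -
  have "(\<Sum>i\<in>{1..n}. of_bool (real i / real n < t)) = real (card {i\<in>{1..n}. real i < t * real n})"
    using assms(3) by (simp add: sum.If_cases of_bool_def pos_divide_less_eq Int_def)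
  moreover have "0 \<le> t * real n" "t * real n \<le> real n"
    using assms by (auto intro: mult_left_le_one_le)
  ultimately show "(\<Sum>i\<in>{1..n}. of_bool (real i / real n < t)) / real n \<le> t"
    "t \<le> (\<Sum>i\<in>{1..n}. of_bool (real i / real n < t)) / real n + 1 / real n"
    using card_below_real[of "t * real n" n] assms(3) by (auto simp: field_simps)
qed

text \<open>A discretized layer-cake formula with error \<open>1 / real n\<close>. Superlevel sets
  of a continuous function are open, so integrals are controlled by measures of finitely many open
  sets.\<close>

lemma superlevel_integral_bounds:
  assumes f: "continuous_map X euclideanreal f" and f01: "\<And>x. x \<in> topspace X \<Longrightarrow> 0 \<le> f x \<and> f x \<le> 1"
    and P: "P \<in> M1 X" and n: "0 < n"
  shows "(\<Sum>i\<in>{1..n}. measure P {x\<in>topspace X. real i / real n < f x}) / real n \<le> integral\<^sup>L P f"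
    "integral\<^sup>L P f \<le> (\<Sum>i\<in>{1..n}. measure P {x\<in>topspace X. real i / real n < f x}) / real n + 1 / real n"
proof -
  interpret prob_space P using P M1_D by blast
  note sp = M1_D(3)[OF P]
  let ?E = "\<lambda>i. {x\<in>topspace X. real i / real n < f x}"
  have E: "?E i \<in> sets P" for i
  proof -
    have "openin X {x\<in>topspace X. f x \<in> {real i / real n<..}}"
      using f by (rule openin_continuous_map_preimage) simp
    then show ?thesis unfolding M1_D(2)[OF P] by (intro openin_in_sets_borel_of) simp
  qed
  define g where "g x = (\<Sum>i\<in>{1..n}. indicat_real (?E i) x) / real n" for x
  have int_ind: "integrable P (indicat_real (?E i))" for i
    using E[of i] by (simp add: integrable_indicator_iff emeasure_eq_measure)
  have int_g: "integrable P g" unfolding g_def using int_ind by simp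
  have "integral\<^sup>L P (indicat_real (?E i)) = measure P (?E i)" for i
    using E[of i] by simp
  then have g: "integral\<^sup>L P g = (\<Sum>i\<in>{1..n}. measure P (?E i)) / real n"
    unfolding g_def using int_ind by (simp add: integral_sum)
  have "bounded_continuous X f" unfolding bounded_continuous_def using f f01 by (intro conjI exI[of _ 1]) auto
  then have int_f: "integrable P f" by (rule bounded_continuous_integrable[OF _ P])
  have g_eq: "g x = (\<Sum>i\<in>{1..n}. of_bool (real i / real n < f x)) / real n" if "x \<in> space P" for x
    using that sp unfolding g_def by (simp add: indicator_def)
  have le: "g x \<le> f x" and ge: "f x \<le> g x + 1 / real n" if "x \<in> space P" for x
    unfolding g_eq[OF that] using superlevel_average_bounds[OF _ _ n, of "f x"] f01 that sp by auto
  show "(\<Sum>i\<in>{1..n}. measure P (?E i)) / real n \<le> integral\<^sup>L P f"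
    unfolding g[symmetric] using int_g int_f le by (intro integral_mono) auto
  have "integral\<^sup>L P f \<le> integral\<^sup>L P (\<lambda>x. g x + 1 / real n)"
    using int_g int_f ge by (intro integral_mono) auto
  also have "\<dots> = integral\<^sup>L P g + 1 / real n" using int_g by (simp add: prob_space)
  finally show "integral\<^sup>L P f \<le> (\<Sum>i\<in>{1..n}. measure P (?E i)) / real n + 1 / real n"
    unfolding g .
qed

text \<open>Finite subfamilies of \<open>\<U>\<close> and rational thresholds keep the family
  countable. Only lower bounds on measures occur; upper bounds on an integral of \<open>f\<close>
  are obtained from lower bounds for \<open>-f\<close>.\<close>

definition tight_subbase :: "'a topology \<Rightarrow> 'a set set \<Rightarrow> 'a measure set set" where
  "tight_subbase X \<U> = insert (M1 X)
     ((\<lambda>(\<V>, r). {P \<in> M1 X. measure P (\<Union>\<V>) > r}) ` ({\<V>. finite \<V> \<and> \<V> \<subseteq> \<U>} \<times> \<rat>))"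

lemma countable_tight_subbase: "countable_basis X \<U> \<Longrightarrow> countable (tight_subbase X \<U>)"
  unfolding tight_subbase_def countable_basis_def
  by (intro countable_insert countable_image countable_SIGMA countable_Collect_finite_subset countable_rat) auto

lemma tight_subbase_cases:
  assumes "S \<in> tight_subbase X \<U>"
  obtains "S = M1 X" | \<V> r where "finite \<V>" "\<V> \<subseteq> \<U>" "S = {P \<in> M1 X. measure P (\<Union>\<V>) > r}"
proof -
  from assms consider "S = M1 X"
    | "S \<in> (\<lambda>(\<V>, r). {P \<in> M1 X. measure P (\<Union>\<V>) > r}) ` ({\<V>. finite \<V> \<and> \<V> \<subseteq> \<U>} \<times> \<rat>)"
    unfolding tight_subbase_def by (elim insertE)
  then show thesis using that by cases auto
qed

text \<open>The integral is replaced by the average of the measures of \<open>n\<close> open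
  superlevel sets, and each of these by a finite union of basis sets. Keeping every such union above
  its threshold costs less than \<open>\<eta>\<close> per set, hence less than \<open>\<eta>\<close>
  in the average.\<close>

lemma tight_subbase_lower_semicontinuous_unit:
  assumes basis: "countable_basis X \<U>"
    and f: "continuous_map X euclideanreal f" and f01: "\<And>x. x \<in> topspace X \<Longrightarrow> 0 \<le> f x \<and> f x \<le> 1"
    and P: "P \<in> M1 X" and c: "integral\<^sup>L P f > c"
  shows "\<exists>W. openin (topology_generated_by (tight_subbase X \<U>)) W \<and> P \<in> W \<and> W \<subseteq> {Q \<in> M1 X. integral\<^sup>L Q f > c}"
proof -
  interpret prob_space P using P M1_D by blast
  obtain n where n: "n > 0" "1 / real n < integral\<^sup>L P f - c"
    using reals_Archimedean[of "integral\<^sup>L P f - c"] c by (metis diff_gt_0_iff_gt inverse_eq_divide zero_less_Suc)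
  define E where "E i = {x\<in>topspace X. real i / real n < f x}" for i
  \<comment> \<open>The slack above \<open>c\<close> that remains after the discretization error
    \<open>1 / real n\<close>.\<close>
  define \<eta> where "\<eta> = (\<Sum>i\<in>{1..n}. measure P (E i)) / real n - c"
  have "\<eta> > 0"
    using superlevel_integral_bounds(2)[OF f f01 P n(1)] n(2) unfolding \<eta>_def E_def by linarith
  have Eo: "openin X (E i)" for i
  proof -
    have "openin X {x\<in>topspace X. f x \<in> {real i / real n<..}}"
      using f by (rule openin_continuous_map_preimage) simp
    then show ?thesis unfolding E_def by simp
  qed
  have "\<exists>\<V> r. finite \<V> \<and> \<V> \<subseteq> \<U> \<and> \<Union>\<V> \<subseteq> E i \<and> r \<in> \<rat> \<and> r < measure P (\<Union>\<V>) \<and> measure P (E i) - \<eta> < r" for i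
  proof -
    obtain \<V> where \<V>: "finite \<V>" "\<V> \<subseteq> \<U>" "\<Union>\<V> \<subseteq> E i" "measure P (E i) < measure P (\<Union>\<V>) + \<eta>"
      using countable_basis_inner_approximation[OF basis finite_measure_axioms M1_D(2)[OF P] Eo[of i] \<open>\<eta> > 0\<close>] by metis
    obtain r where "r \<in> \<rat>" "measure P (E i) - \<eta> < r" "r < measure P (\<Union>\<V>)"
      using Rats_dense_in_real[of "measure P (E i) - \<eta>" "measure P (\<Union>\<V>)"] \<V>(4) by auto
    then show ?thesis using \<V> by (intro exI[of _ \<V>] exI[of _ r]) simp
  qed
  then obtain \<V> r where \<V>: "\<And>i. finite (\<V> i)" "\<And>i. \<V> i \<subseteq> \<U>" "\<And>i. \<Union>(\<V> i) \<subseteq> E i"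
    and r: "\<And>i. r i \<in> \<rat>" "\<And>i. r i < measure P (\<Union>(\<V> i))" "\<And>i. measure P (E i) - \<eta> < r i" by metis
  define W where "W = (\<Inter>i\<in>{1..n}. {Q \<in> M1 X. measure Q (\<Union>(\<V> i)) > r i})"
  have "{Q \<in> M1 X. measure Q (\<Union>(\<V> i)) > r i} \<in> tight_subbase X \<U>" for i
    unfolding tight_subbase_def using \<V>(1,2)[of i] r(1)[of i]
    by (intro insertI2 image_eqI[of _ _ "(\<V> i, r i)"]) auto
  then have "openin (topology_generated_by (tight_subbase X \<U>)) W"
    unfolding W_def using n(1) by (intro openin_Inter) (auto intro: topology_generated_by_Basis)
  moreover have "P \<in> W" unfolding W_def using P r(2) by blast
  moreover have "integral\<^sup>L Q f > c" and "Q \<in> M1 X" if "Q \<in> W" for Q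
  proof -
    have "1 \<in> {1..n}" using n(1) by simp
    then show Q: "Q \<in> M1 X" using that unfolding W_def by blast
    then interpret Q: prob_space Q using M1_D by blast
    have "measure P (E i) - \<eta> < measure Q (E i)" if "i \<in> {1..n}" for i
    proof -
      have "E i \<in> sets Q" unfolding M1_D(2)[OF Q] by (rule openin_in_sets_borel_of[OF Eo])
      then have "measure Q (\<Union>(\<V> i)) \<le> measure Q (E i)" using \<V>(3) by (intro Q.finite_measure_mono) auto
      moreover have "r i < measure Q (\<Union>(\<V> i))" using \<open>Q \<in> W\<close> that unfolding W_def by blast
      ultimately show ?thesis using r(3)[of i] by linarith
    qed
    then have "(\<Sum>i\<in>{1..n}. measure P (E i) - \<eta>) < (\<Sum>i\<in>{1..n}. measure Q (E i))"
      using n(1) by (intro sum_strict_mono) auto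
    then have "((\<Sum>i\<in>{1..n}. measure P (E i)) - real n * \<eta>) / real n < (\<Sum>i\<in>{1..n}. measure Q (E i)) / real n"
      using n(1) by (intro divide_strict_right_mono) (auto simp: sum_subtractf)
    then have "(\<Sum>i\<in>{1..n}. measure P (E i)) / real n - \<eta> < (\<Sum>i\<in>{1..n}. measure Q (E i)) / real n"
      using n(1) by (simp add: diff_divide_distrib)
    also have "\<dots> \<le> integral\<^sup>L Q f"
      using superlevel_integral_bounds(1)[OF f f01 Q n(1)] unfolding E_def .
    finally show "integral\<^sup>L Q f > c" unfolding \<eta>_def by simp
  qed
  ultimately show ?thesis by blast
qed

lemma tight_subbase_lower_semicontinuous:
  assumes basis: "countable_basis X \<U>" and f: "bounded_continuous X f"
    and P: "P \<in> M1 X" and c: "integral\<^sup>L P f > c"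
  shows "\<exists>W. openin (topology_generated_by (tight_subbase X \<U>)) W \<and> P \<in> W \<and> W \<subseteq> {Q \<in> M1 X. integral\<^sup>L Q f > c}"
proof -
  obtain B0 where B0: "\<And>x. x \<in> topspace X \<Longrightarrow> \<bar>f x\<bar> \<le> B0"
    using f by (auto simp: bounded_continuous_def)
  \<comment> \<open>The maximum with 1 makes \<open>2 * B\<close> a positive divisor whatever bound
    \<open>B0\<close> was supplied; \<open>g\<close> then takes values in the unit interval.\<close>
  define B where "B = max B0 1"
  have B: "B > 0" "\<And>x. x \<in> topspace X \<Longrightarrow> \<bar>f x\<bar> \<le> B" using B0 unfolding B_def by force+
  define g where "g x = (f x + B) / (2 * B)" for x
  have gc: "continuous_map X euclideanreal g"
    unfolding g_def using f B(1) by (auto simp: bounded_continuous_def intro!: continuous_intros)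
  have g01: "0 \<le> g x \<and> g x \<le> 1" if "x \<in> topspace X" for x
    using B(2)[OF that] B(1) unfolding g_def by (auto simp: field_simps abs_le_iff)
  have ig: "integral\<^sup>L Q g = (integral\<^sup>L Q f + B) / (2 * B)" if Q: "Q \<in> M1 X" for Q
  proof -
    interpret Q: prob_space Q using Q M1_D by blast
    show ?thesis
      unfolding g_def using bounded_continuous_integrable[OF f Q] by (simp add: Q.prob_space)
  qed
  have iff: "integral\<^sup>L Q g > (c + B) / (2 * B) \<longleftrightarrow> integral\<^sup>L Q f > c" if "Q \<in> M1 X" for Q
    unfolding ig[OF that] using B(1) by (simp add: divide_less_cancel)
  show ?thesis
    using tight_subbase_lower_semicontinuous_unit[OF basis gc g01 P, of "(c + B) / (2 * B)"] iff P c
    by (metis (no_types, lifting) Collect_cong)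
qed

text \<open>Subbase members are open by lower semicontinuity on open sets. Conversely, a
  neighbourhood of an integral value contains an interval, whose two ends are controlled through
  \<open>f\<close> and \<open>-f\<close>. The gain is second countability of the tight
  topology.\<close>

lemma tight_top_eq_generated:
  assumes metr: "metrizable_space X" and basis: "countable_basis X \<U>"
  shows "tight_top X = topology_generated_by (tight_subbase X \<U>)"
proof -
  let ?T = "topology_generated_by (tight_subbase X \<U>)"
  have "openin (tight_top X) V" if "openin ?T V" for V
  proof (rule generate_topology_on_coarsest)
    show "generate_topology_on (tight_subbase X \<U>) V" using that openin_topology_generated_by by blast
    fix S assume "S \<in> tight_subbase X \<U>"
    then show "openin (tight_top X) S"
    proof (cases rule: tight_subbase_cases)
      case 1
      then show ?thesis using openin_topspace[of "tight_top X"] by simp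
    next
      case (2 \<V> r)
      have "openin X (\<Union>\<V>)" using 2 basis by (intro openin_Union) (auto simp: countable_basis_def)
      then show ?thesis unfolding 2(3) by (rule openin_tight_top_measure_greater[OF metr])
    qed
  qed simp
  moreover have "openin ?T V" if "openin (tight_top X) V" for V
  proof (rule generate_topology_on_coarsest)
    let ?S = "{M1 X} \<union> {{P \<in> M1 X. integral\<^sup>L P f \<in> V} | f V. bounded_continuous X f \<and> open V}"
    show "generate_topology_on ?S V"
      using that openin_topology_generated_by unfolding tight_top_def by blast
    fix S assume "S \<in> ?S"
    then consider "S = M1 X" | f V where "bounded_continuous X f" "open V" "S = {P \<in> M1 X. integral\<^sup>L P f \<in> V}"
      by blast
    then show "openin ?T S"
    proof cases
      case 1
      then show ?thesis by (auto intro!: topology_generated_by_Basis simp: tight_subbase_def)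
    next
      case 2
      have "\<exists>W. openin ?T W \<and> P \<in> W \<and> W \<subseteq> S" if "P \<in> S" for P
      proof -
        have P: "P \<in> M1 X" "integral\<^sup>L P f \<in> V" using that 2(3) by auto
        obtain e where e: "e > 0" "\<And>y. dist y (integral\<^sup>L P f) < e \<Longrightarrow> y \<in> V"
          using 2(2) P(2) unfolding open_dist by blast
        have mf: "bounded_continuous X (\<lambda>x. - f x)"
          using 2(1) by (auto simp: bounded_continuous_def intro!: continuous_map_minus)
        obtain W1 where W1: "openin ?T W1" "P \<in> W1" "W1 \<subseteq> {Q \<in> M1 X. integral\<^sup>L Q f > integral\<^sup>L P f - e}"
          using tight_subbase_lower_semicontinuous[OF basis 2(1) P(1), of "integral\<^sup>L P f - e"] e(1) by auto
        obtain W2 where W2: "openin ?T W2" "P \<in> W2"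
            "W2 \<subseteq> {Q \<in> M1 X. integral\<^sup>L Q (\<lambda>x. - f x) > - integral\<^sup>L P f - e}"
          using tight_subbase_lower_semicontinuous[OF basis mf P(1), of "- integral\<^sup>L P f - e"] e(1) by auto
        have "W1 \<inter> W2 \<subseteq> S"
        proof
          fix Q assume "Q \<in> W1 \<inter> W2"
          then have "Q \<in> M1 X" "integral\<^sup>L Q f > integral\<^sup>L P f - e" "- integral\<^sup>L Q f > - integral\<^sup>L P f - e"
            using W1(3) W2(3) by auto
          then show "Q \<in> S" unfolding 2(3) using e(2)[of "integral\<^sup>L Q f"] by (auto simp: dist_real_def)
        qed
        then show ?thesis using W1 W2 by (intro exI[of _ "W1 \<inter> W2"]) auto
      qed
      then show ?thesis by (subst openin_subopen) blast
    qed
  qed simp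
  ultimately show ?thesis by (auto simp: topology_eq)
qed

text \<open>The countable subbase consists of conditions on evaluations, which gives one
  inclusion.\<close>

lemma sets_borel_of_tight_top:
  assumes pol: "Polish_space X" and basis: "countable_basis X \<U>"
  shows "sets (borel_of (tight_top X)) = sets (prob_algebra (borel_of X))"
proof
  have metr: "metrizable_space X"
    using pol by (simp add: Polish_space_def completely_metrizable_imp_metrizable_space)
  note M1 = M1_eq_space_prob_algebra[OF pol]
  have U: "\<Union>(tight_subbase X \<U>) = M1 X" unfolding tight_subbase_def by auto
  have "S \<in> sets (prob_algebra (borel_of X))" if "S \<in> tight_subbase X \<U>" for S
  proof -
    from that show ?thesis
    proof (cases rule: tight_subbase_cases)
      case (2 \<V> r)
      have "openin X (\<Union>\<V>)" using 2 basis by (intro openin_Union) (auto simp: countable_basis_def)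
      then have [measurable]: "\<Union>\<V> \<in> sets (borel_of X)" by (rule openin_in_sets_borel_of)
      show ?thesis unfolding 2(3) M1 by measurable
    qed (simp add: M1)
  qed
  then show "sets (borel_of (tight_top X)) \<subseteq> sets (prob_algebra (borel_of X))"
    unfolding tight_top_eq_generated[OF metr basis]
      sets_borel_of_topology_generated_by[OF countable_tight_subbase[OF basis]] U M1
    by (intro sets.sigma_sets_subset) auto
  \<comment> \<open>For the other inclusion, evaluations at open sets are lower semicontinuous,
    hence Borel, and open sets form an intersection-stable generator.\<close>
  have id: "(\<lambda>P. P) \<in> borel_of (tight_top X) \<rightarrow>\<^sub>M prob_algebra (borel_of X)"
  proof (rule measurable_prob_algebra_generated[OF sets_borel_of])
    show "Int_stable {U. openin X U}" by (auto intro!: Int_stableI)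
    show "{U. openin X U} \<subseteq> Pow (topspace X)" using openin_subset by fast
    fix V assume "V \<in> {U. openin X U}"
    then have V: "openin X V" by simp
    have "(\<lambda>P. measure P V) \<in> borel_measurable (borel_of (tight_top X))"
      unfolding borel_measurable_iff_greater
      using openin_in_sets_borel_of[OF openin_tight_top_measure_greater[OF metr V]] by simp
    then have "(\<lambda>P. ennreal (measure P V)) \<in> borel_measurable (borel_of (tight_top X))" by simp
    moreover have "emeasure P V = ennreal (measure P V)" if "P \<in> space (borel_of (tight_top X))" for P
    proof -
      interpret prob_space P using that M1_D(1)[of P X] by simp
      show ?thesis by (rule emeasure_eq_measure)
    qed
    ultimately show "(\<lambda>P. emeasure P V) \<in> borel_measurable (borel_of (tight_top X))"
      by (subst measurable_cong[where g = "\<lambda>P. ennreal (measure P V)"]) auto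
  qed (simp_all add: M1_D(1)[of _ X] M1_D(2)[of _ X])
  have "(\<lambda>P. P) -` A \<inter> M1 X \<in> sets (borel_of (tight_top X))" if "A \<in> sets (prob_algebra (borel_of X))" for A
    using measurable_sets[OF id that] by simp
  moreover have "(\<lambda>P. P) -` A \<inter> M1 X = A" if "A \<in> sets (prob_algebra (borel_of X))" for A
    using sets.sets_into_space[OF that] unfolding M1 by fast
  ultimately show "sets (prob_algebra (borel_of X)) \<subseteq> sets (borel_of (tight_top X))"
    by (metis subsetI)
qed

subsection \<open>Simplices of probability vectors\<close>

lemma topspace_simplex_top [simp]: "topspace (simplex_top \<alpha>) = simplexM \<alpha>"
  unfolding simplex_top_def topspace_subtopology topspace_product_topology
  by (simp add: Int_absorb1 subset_iff PiE_def simplexM_def)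

lemma simplexM_in_sets_PiM:
  assumes "finite \<alpha>"
  shows "simplexM \<alpha> \<in> sets (PiM \<alpha> (\<lambda>_. borel))"
proof -
  have "simplexM \<alpha> = {p \<in> space (PiM \<alpha> (\<lambda>_. borel :: real measure)). (\<forall>A\<in>\<alpha>. 0 \<le> p A) \<and> (\<Sum>A\<in>\<alpha>. p A) = 1}"
    by (auto simp: simplexM_def space_PiM PiE_def)
  also have "\<dots> \<in> sets (PiM \<alpha> (\<lambda>_. borel))"
    using assms by measurable
  finally show ?thesis .
qed

text \<open>Rational endpoints that are extensional on the finite set \<open>\<alpha>\<close> leave
  only countably many boxes, so Borel sets of the simplex are traces of product-measurable sets and
  measurability can be tested on coordinates.\<close>

lemma simplex_box_base:
  assumes fin: "finite \<alpha>" and W: "openin (simplex_top \<alpha>) W" "p \<in> W"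
  shows "\<exists>a\<in>\<alpha> \<rightarrow>\<^sub>E \<rat>. \<exists>b\<in>\<alpha> \<rightarrow>\<^sub>E \<rat>. p \<in> simplexM \<alpha> \<inter> (\<Pi>\<^sub>E A\<in>\<alpha>. {a A<..<b A}) \<and>
    simplexM \<alpha> \<inter> (\<Pi>\<^sub>E A\<in>\<alpha>. {a A<..<b A}) \<subseteq> W"
proof -
  obtain V where V: "openin (product_topology (\<lambda>_. euclideanreal) \<alpha>) V" "W = V \<inter> simplexM \<alpha>"
    using W(1) unfolding simplex_top_def openin_subtopology by blast
  then obtain U where U: "\<forall>A\<in>\<alpha>. openin euclideanreal (U A)" "p \<in> Pi\<^sub>E \<alpha> U" "Pi\<^sub>E \<alpha> U \<subseteq> V"
    using W(2) unfolding openin_product_topology_alt by (metis IntD1)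
  have "\<exists>a b. a \<in> \<rat> \<and> b \<in> \<rat> \<and> p A \<in> {a<..<b} \<and> {a<..<b} \<subseteq> U A" if A: "A \<in> \<alpha>" for A
  proof -
    have "open (U A)" "p A \<in> U A" using U A by auto
    then obtain e where e: "e > 0" "ball (p A) e \<subseteq> U A" by (meson open_contains_ball)
    obtain a where a: "a \<in> \<rat>" "p A - e < a" "a < p A" using Rats_dense_in_real[of "p A - e" "p A"] e(1) by auto
    obtain b where b: "b \<in> \<rat>" "p A < b" "b < p A + e" using Rats_dense_in_real[of "p A" "p A + e"] e(1) by auto
    have "{a<..<b} \<subseteq> ball (p A) e" using a b by (auto simp: dist_real_def)
    then show ?thesis using a b e by (intro exI[of _ a] exI[of _ b]) auto
  qed
  then obtain a b where ab: "\<And>A. A \<in> \<alpha> \<Longrightarrow> a A \<in> \<rat> \<and> b A \<in> \<rat> \<and> p A \<in> {a A<..<b A} \<and> {a A<..<b A} \<subseteq> U A"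
    by metis
  let ?a = "restrict a \<alpha>" and ?b = "restrict b \<alpha>"
  have "p \<in> simplexM \<alpha>" using W(2) V(2) by blast
  moreover have "p \<in> extensional \<alpha>" using U(2) by (auto simp: PiE_def)
  then have "p \<in> (\<Pi>\<^sub>E A\<in>\<alpha>. {?a A<..<?b A})" using ab by (auto simp: PiE_def)
  moreover have "(\<Pi>\<^sub>E A\<in>\<alpha>. {?a A<..<?b A}) \<subseteq> Pi\<^sub>E \<alpha> U"
    using ab by (intro PiE_mono) auto
  then have "simplexM \<alpha> \<inter> (\<Pi>\<^sub>E A\<in>\<alpha>. {?a A<..<?b A}) \<subseteq> W"
    using U(3) V(2) by blast
  moreover have "?a \<in> \<alpha> \<rightarrow>\<^sub>E \<rat>" "?b \<in> \<alpha> \<rightarrow>\<^sub>E \<rat>" using ab by auto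
  ultimately show ?thesis by blast
qed

lemma sets_borel_of_simplex_top_subset:
  assumes fin: "finite \<alpha>"
  shows "sets (borel_of (simplex_top \<alpha>)) \<subseteq> sets (restrict_space (PiM \<alpha> (\<lambda>_. borel)) (simplexM \<alpha>))"
proof (rule sets_borel_of_subset_of_base)
  let ?box = "\<lambda>(a, b). simplexM \<alpha> \<inter> (\<Pi>\<^sub>E A\<in>\<alpha>. {a A<..<b A :: real})"
  let ?\<B> = "?box ` ((\<alpha> \<rightarrow>\<^sub>E \<rat>) \<times> (\<alpha> \<rightarrow>\<^sub>E \<rat>))"
  show "countable ?\<B>"
    using fin by (intro countable_image countable_SIGMA countable_PiE countable_rat)
  show "?\<B> \<subseteq> sets (restrict_space (PiM \<alpha> (\<lambda>_. borel)) (simplexM \<alpha>))"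
    using fin by (auto simp: sets_restrict_space intro!: imageI sets_PiM_I_finite)
  have "space (restrict_space (PiM \<alpha> (\<lambda>_. borel :: real measure)) (simplexM \<alpha>)) = simplexM \<alpha>"
    using sets.sets_into_space[OF simplexM_in_sets_PiM[OF fin]] by (auto simp: space_restrict_space)
  then show "sigma_algebra (topspace (simplex_top \<alpha>)) (sets (restrict_space (PiM \<alpha> (\<lambda>_. borel)) (simplexM \<alpha>)))"
    by (metis sets.sigma_algebra_axioms topspace_simplex_top)
  show "\<exists>V\<in>?\<B>. p \<in> V \<and> V \<subseteq> W" if W: "openin (simplex_top \<alpha>) W" "p \<in> W" for W p
  proof -
    obtain a b where "a \<in> \<alpha> \<rightarrow>\<^sub>E \<rat>" "b \<in> \<alpha> \<rightarrow>\<^sub>E \<rat>" "p \<in> ?box (a, b)" "?box (a, b) \<subseteq> W"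
      using simplex_box_base[OF fin W] by auto
    moreover then have "?box (a, b) \<in> ?\<B>" by (intro imageI SigmaI)
    ultimately show ?thesis by meson
  qed
qed

lemma measurable_into_simplex:
  assumes fin: "finite \<alpha>" and f: "f \<in> space M \<rightarrow> simplexM \<alpha>"
    and meas: "\<And>A. A \<in> \<alpha> \<Longrightarrow> (\<lambda>x. f x A) \<in> borel_measurable M"
  shows "f \<in> M \<rightarrow>\<^sub>M borel_of (simplex_top \<alpha>)"
proof (rule measurable_into_borel_of)
  have ext: "f x \<in> extensional \<alpha>" if "x \<in> space M" for x
    using f that by (auto simp: simplexM_def)
  have "f \<in> M \<rightarrow>\<^sub>M PiM \<alpha> (\<lambda>_. borel)"
    using ext meas by (intro measurable_PiM_single') (auto simp: PiE_def)
  then have f': "f \<in> M \<rightarrow>\<^sub>M restrict_space (PiM \<alpha> (\<lambda>_. borel)) (simplexM \<alpha>)"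
    using f by (intro measurable_restrict_space2)
  show "f -` U \<inter> space M \<in> sets M" if "openin (simplex_top \<alpha>) U" for U
    using measurable_sets[OF f'] openin_in_sets_borel_of[OF that] sets_borel_of_simplex_top_subset[OF fin] by blast
qed (use f in simp)

lemma simplex_coordinate_measurable [measurable]:
  assumes "A \<in> \<alpha>"
  shows "(\<lambda>p. p A) \<in> borel_measurable (borel_of (simplex_top \<alpha>))"
proof -
  have "continuous_map (simplex_top \<alpha>) euclideanreal (\<lambda>p. p A)"
    unfolding simplex_top_def
    by (intro continuous_map_from_subtopology continuous_map_product_projection assms)
  then show ?thesis by (metis continuous_map_measurable borel_of_euclidean)
qed

subsection \<open>Sets that are unions of partition cells\<close>

definition saturated :: "'a set set \<Rightarrow> 'a set \<Rightarrow> bool" where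
  "saturated \<alpha> C \<longleftrightarrow> C \<subseteq> \<Union>\<alpha> \<and> (\<forall>A\<in>\<alpha>. A \<subseteq> C \<or> A \<inter> C = {})"

lemma saturated_refine:
  assumes "refines \<gamma> \<alpha>" "\<Union>\<gamma> = \<Union>\<alpha>" "saturated \<alpha> C"
  shows "saturated \<gamma> C"
  unfolding saturated_def
proof (intro conjI ballI)
  show "C \<subseteq> \<Union>\<gamma>" using assms(2,3) by (simp add: saturated_def)
  fix B assume "B \<in> \<gamma>"
  then obtain A where "A \<in> \<alpha>" "B \<subseteq> A" using assms(1) by (auto simp: refines_def)
  then show "B \<subseteq> C \<or> B \<inter> C = {}" using assms(3) unfolding saturated_def by blast
qed

lemma saturated_Un: "saturated \<alpha> C \<Longrightarrow> saturated \<alpha> D \<Longrightarrow> saturated \<alpha> (C \<union> D)"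
  unfolding saturated_def by blast

lemma saturated_Compl: "saturated \<alpha> C \<Longrightarrow> saturated \<alpha> (\<Union>\<alpha> - C)"
  unfolding saturated_def by blast

lemma saturated_cells_Union: "saturated \<alpha> C \<Longrightarrow> \<Union>{A\<in>\<alpha>. A \<subseteq> C} = C"
  unfolding saturated_def by blast

lemma is_partition_disjoint:
  assumes "is_partition X \<alpha>" "A \<in> \<alpha>" "B \<in> \<alpha>"
  shows "A = B \<or> A \<inter> B = {}"
  using assms unfolding is_partition_def disjoint_def by meson

lemma saturated_cell:
  assumes "is_partition X \<alpha>" "A \<in> \<alpha>"
  shows "saturated \<alpha> A"
  using is_partition_disjoint[OF assms(1) _ assms(2)] assms(2) unfolding saturated_def by auto

text \<open>The charge on the finite algebra of unions of cells that the vector \<open>p\<close>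
  represents. It is meaningful for saturated \<open>C\<close>; for other sets, cells that cross the
  boundary are dropped.\<close>

definition mass :: "'a set set \<Rightarrow> ('a set \<Rightarrow> real) \<Rightarrow> 'a set \<Rightarrow> real" where
  "mass \<alpha> p C = (\<Sum>A\<in>{A\<in>\<alpha>. A \<subseteq> C}. p A)"

lemma mass_measurable [measurable]: "(\<lambda>p. mass \<alpha> p C) \<in> borel_measurable (borel_of (simplex_top \<alpha>))"
  unfolding mass_def by (intro borel_measurable_sum simplex_coordinate_measurable) simp

lemma mass_nonneg: "p \<in> simplexM \<alpha> \<Longrightarrow> 0 \<le> mass \<alpha> p C"
  unfolding mass_def by (intro sum_nonneg) (auto simp: simplexM_def)

lemma mass_topspace: "is_partition X \<alpha> \<Longrightarrow> p \<in> simplexM \<alpha> \<Longrightarrow> mass \<alpha> p (topspace X) = 1"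
proof -
  assume "is_partition X \<alpha>" "p \<in> simplexM \<alpha>"
  moreover then have "{A\<in>\<alpha>. A \<subseteq> topspace X} = \<alpha>" by (auto simp: is_partition_def)
  ultimately show ?thesis by (simp add: mass_def simplexM_def)
qed

lemma mass_Un:
  assumes part: "is_partition X \<alpha>" and sat: "saturated \<alpha> C" "saturated \<alpha> D" and "C \<inter> D = {}"
  shows "mass \<alpha> p (C \<union> D) = mass \<alpha> p C + mass \<alpha> p D"
proof -
  have "{A\<in>\<alpha>. A \<subseteq> C \<union> D} = {A\<in>\<alpha>. A \<subseteq> C} \<union> {A\<in>\<alpha>. A \<subseteq> D}"
    using sat unfolding saturated_def by blast
  moreover have "{A\<in>\<alpha>. A \<subseteq> C} \<inter> {A\<in>\<alpha>. A \<subseteq> D} = {}"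
    using part \<open>C \<inter> D = {}\<close> unfolding is_partition_def by blast
  moreover have "finite \<alpha>" using part by (simp add: is_partition_def)
  ultimately show ?thesis unfolding mass_def by (simp add: sum.union_disjoint)
qed

lemma mass_cell:
  assumes part: "is_partition X \<alpha>" and A: "A \<in> \<alpha>"
  shows "mass \<alpha> p A = p A"
proof -
  have "{A'\<in>\<alpha>. A' \<subseteq> A} = {A}"
  proof (intro set_eqI iffI)
    fix B assume "B \<in> {A'\<in>\<alpha>. A' \<subseteq> A}"
    then have B: "B \<in> \<alpha>" "B \<subseteq> A" by auto
    then have "B \<noteq> {}" using part by (auto simp: is_partition_def)
    then show "B \<in> {A}" using is_partition_disjoint[OF part B(1) A] B(2) by auto
  qed (use A in auto)
  then show ?thesis by (simp add: mass_def)
qed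

text \<open>A non-empty cell of \<open>\<gamma>\<close> inside \<open>C\<close> lies in a single
  cell of \<open>\<alpha>\<close>, which saturation forces into \<open>C\<close>. Grouping the sum
  accordingly shows that the charge of \<open>C\<close> does not depend on the partition on which it
  is computed.\<close>

lemma mass_phi:
  assumes part: "is_partition X \<alpha>" "is_partition X \<gamma>" and ref: "refines \<gamma> \<alpha>" and sat: "saturated \<alpha> C"
  shows "mass \<alpha> (phi \<alpha> \<gamma> p) C = mass \<gamma> p C"
proof -
  have fin: "finite \<alpha>" "finite \<gamma>" using part by (auto simp: is_partition_def)
  have ne: "B \<noteq> {}" if "B \<in> \<gamma>" for B using that part(2) by (auto simp: is_partition_def)
  have "mass \<gamma> p C = sum p (\<Union>A\<in>{A\<in>\<alpha>. A \<subseteq> C}. {B\<in>\<gamma>. B \<subseteq> A})"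
  proof -
    have "{B\<in>\<gamma>. B \<subseteq> C} = (\<Union>A\<in>{A\<in>\<alpha>. A \<subseteq> C}. {B\<in>\<gamma>. B \<subseteq> A})"
    proof (intro set_eqI iffI)
      fix B assume B: "B \<in> {B\<in>\<gamma>. B \<subseteq> C}"
      then obtain A where A: "A \<in> \<alpha>" "B \<subseteq> A" using ref unfolding refines_def by blast
      then have "A \<subseteq> C" using sat ne[of B] B unfolding saturated_def by blast
      then show "B \<in> (\<Union>A\<in>{A\<in>\<alpha>. A \<subseteq> C}. {B\<in>\<gamma>. B \<subseteq> A})" using A B by blast
    qed blast
    then show ?thesis by (simp add: mass_def)
  qed
  also have "\<dots> = (\<Sum>A\<in>{A\<in>\<alpha>. A \<subseteq> C}. \<Sum>B\<in>{B\<in>\<gamma>. B \<subseteq> A}. p B)"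
  proof (rule sum.UNION_disjoint)
    show "\<forall>A\<in>{A\<in>\<alpha>. A \<subseteq> C}. \<forall>A'\<in>{A\<in>\<alpha>. A \<subseteq> C}. A \<noteq> A' \<longrightarrow> {B\<in>\<gamma>. B \<subseteq> A} \<inter> {B\<in>\<gamma>. B \<subseteq> A'} = {}"
    proof (intro ballI impI)
      fix A A' assume "A \<in> {A\<in>\<alpha>. A \<subseteq> C}" "A' \<in> {A\<in>\<alpha>. A \<subseteq> C}" "A \<noteq> A'"
      then have "A \<inter> A' = {}" using part(1) by (auto simp: is_partition_def disjoint_def)
      then show "{B\<in>\<gamma>. B \<subseteq> A} \<inter> {B\<in>\<gamma>. B \<subseteq> A'} = {}" using ne by blast
    qed
  qed (use fin in auto)
  also have "\<dots> = mass \<alpha> (phi \<alpha> \<gamma> p) C" unfolding mass_def phi_def by simp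
  finally show ?thesis ..
qed

lemma phi_eq_mass: "A \<in> \<alpha> \<Longrightarrow> phi \<alpha> \<gamma> p A = mass \<gamma> p A"
  by (simp add: phi_def mass_def)

lemma phi_in_simplexM:
  assumes part: "is_partition X \<alpha>" "is_partition X \<gamma>" and ref: "refines \<gamma> \<alpha>" and p: "p \<in> simplexM \<gamma>"
  shows "phi \<alpha> \<gamma> p \<in> simplexM \<alpha>"
proof -
  have top: "saturated \<alpha> (topspace X)" using part(1) by (auto simp: saturated_def is_partition_def)
  have "{A\<in>\<alpha>. A \<subseteq> topspace X} = \<alpha>" using part(1) by (auto simp: is_partition_def)
  then have "(\<Sum>A\<in>\<alpha>. phi \<alpha> \<gamma> p A) = mass \<alpha> (phi \<alpha> \<gamma> p) (topspace X)" by (simp add: mass_def)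
  also have "\<dots> = 1" using mass_phi[OF part ref top] mass_topspace[OF part(2) p] by simp
  finally show ?thesis
    using mass_nonneg[OF p] by (auto simp: simplexM_def phi_eq_mass) (simp add: phi_def)
qed

lemma phi_measurable:
  assumes part: "is_partition X \<alpha>" "is_partition X \<gamma>" and ref: "refines \<gamma> \<alpha>"
  shows "phi \<alpha> \<gamma> \<in> borel_of (simplex_top \<gamma>) \<rightarrow>\<^sub>M borel_of (simplex_top \<alpha>)"
proof (rule measurable_into_simplex)
  show "finite \<alpha>" using part by (simp add: is_partition_def)
  show "phi \<alpha> \<gamma> \<in> space (borel_of (simplex_top \<gamma>)) \<rightarrow> simplexM \<alpha>" using phi_in_simplexM[OF part ref] by simp
qed (simp add: phi_eq_mass)

lemma mass_proj:
  assumes part: "is_partition X \<alpha>" and sat: "saturated \<alpha> C" and P: "P \<in> M1 X"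
  shows "mass \<alpha> (proj \<alpha> P) C = measure P C"
proof -
  interpret prob_space P using P M1_D by blast
  have "measure P (\<Union>A\<in>{A\<in>\<alpha>. A \<subseteq> C}. A) = (\<Sum>A\<in>{A\<in>\<alpha>. A \<subseteq> C}. measure P A)"
    using part M1_D(2)[OF P]
    by (intro finite_measure_finite_Union) (auto simp: is_partition_def disjoint_def disjoint_family_on_def)
  then show ?thesis
    using saturated_cells_Union[OF sat] by (simp add: mass_def proj_def)
qed

lemma proj_in_simplexM:
  assumes part: "is_partition X \<alpha>" and P: "P \<in> M1 X"
  shows "proj \<alpha> P \<in> simplexM \<alpha>"
proof -
  interpret prob_space P using P M1_D by blast
  have top: "saturated \<alpha> (topspace X)" using part by (auto simp: saturated_def is_partition_def)
  have "{A\<in>\<alpha>. A \<subseteq> topspace X} = \<alpha>" using part by (auto simp: is_partition_def)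
  then have "(\<Sum>A\<in>\<alpha>. proj \<alpha> P A) = mass \<alpha> (proj \<alpha> P) (topspace X)" by (simp add: mass_def)
  also have "\<dots> = measure P (space P)" using mass_proj[OF part top P] M1_D(3)[OF P] by simp
  finally show ?thesis by (auto simp: simplexM_def proj_def prob_space)
qed

lemma proj_measurable:
  assumes pol: "Polish_space X" and part: "is_partition X \<alpha>"
  shows "proj \<alpha> \<in> prob_algebra (borel_of X) \<rightarrow>\<^sub>M borel_of (simplex_top \<alpha>)"
proof (rule measurable_into_simplex)
  show "finite \<alpha>" using part by (simp add: is_partition_def)
  show "proj \<alpha> \<in> space (prob_algebra (borel_of X)) \<rightarrow> simplexM \<alpha>"
    using proj_in_simplexM[OF part] M1_eq_space_prob_algebra[OF pol] by auto
  fix A assume A: "A \<in> \<alpha>"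
  then have [measurable]: "A \<in> sets (borel_of X)" using part by (simp add: is_partition_def)
  show "(\<lambda>P. proj \<alpha> P A) \<in> borel_measurable (prob_algebra (borel_of X))"
    using A by (simp add: proj_def)
qed

subsection \<open>The zero-dimensional refinement\<close>

lemma topspace_hat_top: "countable_basis X \<U> \<Longrightarrow> topspace (hat_top X \<U>) = topspace X"
proof -
  assume "countable_basis X \<U>"
  then have "\<Union>\<U> \<subseteq> topspace X" unfolding countable_basis_def by (meson Sup_least openin_subset)
  then show ?thesis unfolding hat_top_def topology_generated_by_topspace by auto
qed

text \<open>The subbasis of the refinement is closed under complements, so its members are clopen,
  and finite unions of finite intersections preserve this.\<close>

lemma gen_by_clopen:
  assumes basis: "countable_basis X \<U>" and A: "gen_by X \<U> A"
  shows "openin (hat_top X \<U>) A" "closedin (hat_top X \<U>) A"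
proof -
  let ?H = "hat_top X \<U>" and ?S = "\<U> \<union> {topspace X - U | U. U \<in> \<U>}"
  have base: "openin ?H S \<and> closedin ?H S" if "S \<in> ?S" for S
  proof -
    have op: "openin ?H S" if "S \<in> ?S" for S
      unfolding hat_top_def using that by (intro topology_generated_by_Basis) blast
    have sub: "S \<subseteq> topspace X" using that basis openin_subset unfolding countable_basis_def by blast
    have "topspace X - S \<in> ?S"
      using that basis openin_subset[of X] unfolding countable_basis_def by (auto simp: double_diff)
    then show ?thesis using op[OF that] op sub by (simp add: closedin_def topspace_hat_top[OF basis])
  qed
  obtain \<F> where \<F>: "finite \<F>" "\<And>S. S \<in> \<F> \<Longrightarrow> finite S \<and> S \<subseteq> ?S" "A = (\<Union>S\<in>\<F>. topspace X \<inter> \<Inter>S)"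
    using A unfolding gen_by_def by blast
  have *: "openin ?H (topspace X \<inter> \<Inter>S) \<and> closedin ?H (topspace X \<inter> \<Inter>S)" if "finite S" "S \<subseteq> ?S" for S
    using that
  proof (induction S)
    case empty
    then show ?case using topspace_hat_top[OF basis] by (metis Inf_empty closedin_topspace inf_top.right_neutral openin_topspace)
  next
    case (insert x S)
    then have "openin ?H (x \<inter> (topspace X \<inter> \<Inter>S)) \<and> closedin ?H (x \<inter> (topspace X \<inter> \<Inter>S))"
      using base[of x] by (auto intro!: openin_Int closedin_Int)
    moreover have "x \<inter> (topspace X \<inter> \<Inter>S) = topspace X \<inter> \<Inter>(insert x S)" by auto
    ultimately show ?case by simp
  qed
  show "openin ?H A" unfolding \<F>(3) using * \<F>(2) by (intro openin_Union) auto
  show "closedin ?H A" unfolding \<F>(3) using * \<F>(1,2) by (intro closedin_Union) auto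
qed

lemma countable_gen_by:
  assumes "countable \<U>" shows "countable {A. gen_by X \<U> A}"
proof -
  let ?S = "\<U> \<union> {topspace X - U | U. U \<in> \<U>}"
  have "countable ?S" using assms by (simp add: setcompr_eq_image)
  then have "countable {\<F>. finite \<F> \<and> \<F> \<subseteq> {S. finite S \<and> S \<subseteq> ?S}}"
    by (intro countable_Collect_finite_subset)
  then have "countable ((\<lambda>\<F>. \<Union>S\<in>\<F>. topspace X \<inter> \<Inter>S) ` {\<F>. finite \<F> \<and> \<F> \<subseteq> {S. finite S \<and> S \<subseteq> ?S}})"
    by (rule countable_image)
  then show ?thesis
    by (rule countable_subset[rotated]) (auto simp: gen_by_def)
qed

lemma compactin_decseq_empty:
  assumes K: "compactin H K" and C: "\<And>n. closedin H (C n)" "decseq C" "(\<Inter>n. C n) = {}"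
  shows "\<exists>n::nat. C n \<inter> K = {}"
proof -
  have "K \<subseteq> \<Union>(range (\<lambda>n. topspace H - C n))"
    using compactin_subset_topspace[OF K] C(3) by blast
  moreover have "Ball (range (\<lambda>n. topspace H - C n)) (openin H)" using C(1) by auto
  ultimately obtain \<F> where \<F>: "finite \<F>" "\<F> \<subseteq> range (\<lambda>n. topspace H - C n)" "K \<subseteq> \<Union>\<F>"
    using K unfolding compactin_def by meson
  then obtain I where I: "finite I" "\<F> = (\<lambda>n. topspace H - C n) ` I"
    using finite_subset_image[OF \<F>(1,2)] by blast
  \<comment> \<open>Inserting 0 keeps \<open>Max\<close> defined when the finite subcover is empty,
    which can happen for empty \<open>K\<close>.\<close>
  have "C (Max (insert 0 I)) \<subseteq> C n" if "n \<in> I" for n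
    using that I(1) by (intro decseqD[OF C(2)] Max_ge) auto
  then have "C (Max (insert 0 I)) \<inter> K = {}" using \<F>(3) unfolding I(2) by blast
  then show ?thesis ..
qed

subsection \<open>Extension from the algebra of cell unions\<close>

locale resolving_partitions =
  fixes X :: "'a topology" and \<U> :: "'a set set" and \<A> :: "'a set set set"
  assumes polish: "Polish_space X"
    and basis: "countable_basis X \<U>"
    and part: "\<And>\<alpha>. \<alpha> \<in> \<A> \<Longrightarrow> is_partition X \<alpha>"
    and gen: "\<And>\<alpha> A. \<alpha> \<in> \<A> \<Longrightarrow> A \<in> \<alpha> \<Longrightarrow> gen_by X \<U> A"
    and directed: "directed_refinement \<A>"
    and resolving: "resolves X \<A>"
begin

text \<open>An increasing union of finite algebras along the directed family; it is an algebra
  because any two members live on a common refinement.\<close>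

definition cells_algebra :: "'a set set" where
  "cells_algebra = {C. \<exists>\<alpha>\<in>\<A>. saturated \<alpha> C}"

lemma Union_partition: "\<alpha> \<in> \<A> \<Longrightarrow> \<Union>\<alpha> = topspace X"
  using part by (simp add: is_partition_def)

lemma common_refinement:
  assumes "\<alpha> \<in> \<A>" "\<beta> \<in> \<A>"
  obtains \<gamma> where "\<gamma> \<in> \<A>" "refines \<gamma> \<alpha>" "refines \<gamma> \<beta>"
  using assms directed unfolding directed_refinement_def by blast

lemma saturated_refinement:
  assumes "\<alpha> \<in> \<A>" "\<gamma> \<in> \<A>" "refines \<gamma> \<alpha>" "saturated \<alpha> C"
  shows "saturated \<gamma> C"
  using saturated_refine[OF assms(3) _ assms(4)] Union_partition assms(1,2) by simp

text \<open>Directedness in the form used throughout: every computation with finitely many members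
  of the algebra takes place in one simplex.\<close>

lemma finite_common_saturation:
  assumes "finite \<C>" "\<C> \<subseteq> cells_algebra"
  shows "\<exists>\<alpha>\<in>\<A>. \<forall>C\<in>\<C>. saturated \<alpha> C"
  using assms
proof (induction)
  case empty
  then show ?case using directed by (auto simp: directed_refinement_def)
next
  case (insert C \<C>)
  then obtain \<alpha> where \<alpha>: "\<alpha> \<in> \<A>" "\<forall>C\<in>\<C>. saturated \<alpha> C" by auto
  obtain \<beta> where \<beta>: "\<beta> \<in> \<A>" "saturated \<beta> C" using insert by (auto simp: cells_algebra_def)
  obtain \<gamma> where \<gamma>: "\<gamma> \<in> \<A>" "refines \<gamma> \<alpha>" "refines \<gamma> \<beta>" by (rule common_refinement[OF \<alpha>(1) \<beta>(1)])
  have "\<forall>D\<in>insert C \<C>. saturated \<gamma> D"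
    using saturated_refinement[OF \<alpha>(1) \<gamma>(1,2)] saturated_refinement[OF \<beta>(1) \<gamma>(1,3)] \<alpha>(2) \<beta>(2) by auto
  then show ?case using \<gamma>(1) by blast
qed

lemma saturated_in_cells_algebra: "\<alpha> \<in> \<A> \<Longrightarrow> saturated \<alpha> C \<Longrightarrow> C \<in> cells_algebra"
  by (auto simp: cells_algebra_def)

lemma cell_in_cells_algebra: "\<alpha> \<in> \<A> \<Longrightarrow> A \<in> \<alpha> \<Longrightarrow> A \<in> cells_algebra"
  using saturated_in_cells_algebra saturated_cell part by metis

lemma cells_algebra_subset: "C \<in> cells_algebra \<Longrightarrow> C \<subseteq> topspace X"
  using Union_partition by (auto simp: cells_algebra_def saturated_def)

lemma algebra_cells_algebra: "algebra (topspace X) cells_algebra"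
  unfolding algebra_iff_Un
proof (intro conjI ballI)
  show "cells_algebra \<subseteq> Pow (topspace X)" using cells_algebra_subset by blast
  show "{} \<in> cells_algebra"
    using directed by (auto simp: cells_algebra_def saturated_def directed_refinement_def)
  show "topspace X - C \<in> cells_algebra" if C: "C \<in> cells_algebra" for C
  proof -
    obtain \<alpha> where "\<alpha> \<in> \<A>" "saturated \<alpha> C" using C by (auto simp: cells_algebra_def)
    then show ?thesis using saturated_Compl saturated_in_cells_algebra Union_partition by metis
  qed
  show "C \<union> D \<in> cells_algebra" if CD: "C \<in> cells_algebra" "D \<in> cells_algebra" for C D
  proof -
    obtain \<alpha> where "\<alpha> \<in> \<A>" "saturated \<alpha> C" "saturated \<alpha> D"
      using finite_common_saturation[of "{C, D}"] CD by auto
    then show ?thesis using saturated_Un saturated_in_cells_algebra by metis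
  qed
qed

lemma cells_algebra_finite_Union:
  assumes "C \<in> cells_algebra"
  shows "\<exists>\<S>. finite \<S> \<and> \<S> \<subseteq> \<Union>\<A> \<and> C = \<Union>\<S>"
proof -
  obtain \<alpha> where \<alpha>: "\<alpha> \<in> \<A>" "saturated \<alpha> C" using assms by (auto simp: cells_algebra_def)
  have "finite {A\<in>\<alpha>. A \<subseteq> C}" using part[OF \<alpha>(1)] by (simp add: is_partition_def)
  moreover have "{A\<in>\<alpha>. A \<subseteq> C} \<subseteq> \<Union>\<A>" using \<alpha>(1) by blast
  ultimately show ?thesis using saturated_cells_Union[OF \<alpha>(2)] by metis
qed

lemma sigma_sets_cells_algebra: "sigma_sets (topspace X) cells_algebra = sets (borel_of X)"
proof
  have res: "sigma_sets (topspace X) (\<Union>\<A>) = sets (borel_of X)"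
    using resolving by (simp add: resolves_def)
  show "sets (borel_of X) \<subseteq> sigma_sets (topspace X) cells_algebra"
    unfolding res[symmetric] using cell_in_cells_algebra by (intro sigma_sets_mono') blast
  have "C \<in> sets (borel_of X)" if C: "C \<in> cells_algebra" for C
  proof -
    obtain \<S> where \<S>: "finite \<S>" "\<S> \<subseteq> \<Union>\<A>" "C = \<Union>\<S>" using cells_algebra_finite_Union[OF C] by blast
    have "\<Union>\<A> \<subseteq> sets (borel_of X)" unfolding res[symmetric] by auto
    then show ?thesis unfolding \<S>(3) using \<S>(1,2) by (intro sets.finite_Union) auto
  qed
  then show "sigma_sets (topspace X) cells_algebra \<subseteq> sets (borel_of X)"
    using sets.sigma_sets_subset[of cells_algebra "borel_of X"] by auto
qed

lemma cells_algebra_borel: "C \<in> cells_algebra \<Longrightarrow> C \<in> sets (borel_of X)"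
  using sigma_sets_cells_algebra by blast

lemma countable_cells_algebra: "countable cells_algebra"
proof -
  have "countable \<U>" using basis by (simp add: countable_basis_def)
  moreover have "\<Union>\<A> \<subseteq> {A. gen_by X \<U> A}" using gen by auto
  ultimately have "countable (\<Union>\<A>)"
    using countable_gen_by countable_subset by metis
  then have "countable (Union ` {\<S>. finite \<S> \<and> \<S> \<subseteq> \<Union>\<A>})"
    by (intro countable_image countable_Collect_finite_subset)
  moreover have "cells_algebra \<subseteq> Union ` {\<S>. finite \<S> \<and> \<S> \<subseteq> \<Union>\<A>}"
    using cells_algebra_finite_Union by blast
  ultimately show ?thesis by (rule countable_subset[rotated])
qed

lemma closedin_hat_top_cells_algebra:
  assumes "C \<in> cells_algebra" shows "closedin (hat_top X \<U>) C"
proof -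
  obtain \<S> where \<S>: "finite \<S>" "\<S> \<subseteq> \<Union>\<A>" "C = \<Union>\<S>" using cells_algebra_finite_Union[OF assms] by blast
  show ?thesis unfolding \<S>(3)
    using \<S>(1,2) gen gen_by_clopen(2)[OF basis] by (intro closedin_Union) auto
qed

text \<open>The deterministic core, for one sample: Caratheodory extension with continuity at the
  empty set as the only point to verify. Since \<open>tight\<close> concerns a single
  \<open>p\<close>, the compact sets may later depend on the sample.\<close>

lemma tight_charge_extends:
  fixes p :: "'a set \<Rightarrow> real"
  assumes nonneg: "\<And>C. C \<in> cells_algebra \<Longrightarrow> 0 \<le> p C" and total: "p (topspace X) = 1"
    and add: "\<And>C D. C \<in> cells_algebra \<Longrightarrow> D \<in> cells_algebra \<Longrightarrow> C \<inter> D = {} \<Longrightarrow> p (C \<union> D) = p C + p D"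
    and tight: "\<And>\<delta>. \<delta> > 0 \<Longrightarrow> \<exists>K. compactin (hat_top X \<U>) K \<and> (\<forall>C\<in>cells_algebra. C \<inter> K = {} \<longrightarrow> p C \<le> \<delta>)"
  shows "\<exists>P\<in>M1 X. \<forall>C\<in>cells_algebra. measure P C = p C"
proof -
  interpret algebra "topspace X" cells_algebra by (rule algebra_cells_algebra)
  let ?f = "\<lambda>C. ennreal (p C)"
  have "p {} = 0" using add[of "{}" "{}"] by simp
  have "\<exists>\<mu>::'a set \<Rightarrow> ennreal. (\<forall>C\<in>cells_algebra. \<mu> C = ?f C) \<and>
      measure_space (topspace X) (sigma_sets (topspace X) cells_algebra) \<mu>"
  proof (rule caratheodory_empty_continuous)
    show "positive cells_algebra ?f" using \<open>p {} = 0\<close> by (simp add: positive_def)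
    show "Measure_Space.additive cells_algebra ?f"
      using add nonneg by (auto simp: Measure_Space.additive_def simp flip: ennreal_plus)
    fix C :: "nat \<Rightarrow> 'a set" assume C: "range C \<subseteq> cells_algebra" "decseq C" "(\<Inter>i. C i) = {}"
    have C': "C i \<in> cells_algebra" for i using C(1) by blast
    have "(\<lambda>i. p (C i)) \<longlonglongrightarrow> 0"
      unfolding LIMSEQ_def
    proof (intro allI impI)
      fix \<delta> :: real assume "\<delta> > 0"
      \<comment> \<open>The bound on \<open>p C\<close> is not strict, so \<open>\<delta>/2\<close>
        is requested to end strictly below \<open>\<delta>\<close>.\<close>
      then obtain K where K: "compactin (hat_top X \<U>) K" "\<forall>C\<in>cells_algebra. C \<inter> K = {} \<longrightarrow> p C \<le> \<delta>/2"
        using tight[of "\<delta>/2"] by auto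
      obtain n where n: "C n \<inter> K = {}"
        using compactin_decseq_empty[OF K(1) closedin_hat_top_cells_algebra[OF C'] C(2,3)] by blast
      have "dist (p (C i)) 0 < \<delta>" if "i \<ge> n" for i
      proof -
        have "C i \<inter> K = {}" using decseqD[OF C(2) that] n by blast
        then have "p (C i) \<le> \<delta> / 2" using K(2) C' by blast
        then show ?thesis using nonneg[OF C'[of i]] \<open>\<delta> > 0\<close> by (simp add: dist_real_def)
      qed
      then show "\<exists>n. \<forall>i\<ge>n. dist (p (C i)) 0 < \<delta>" by blast
    qed
    then show "(\<lambda>i. ?f (C i)) \<longlonglongrightarrow> 0" using tendsto_ennrealI by fastforce
  qed simp
  then obtain \<mu> :: "'a set \<Rightarrow> ennreal" where \<mu>: "\<forall>C\<in>cells_algebra. \<mu> C = ?f C"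
      "measure_space (topspace X) (sigma_sets (topspace X) cells_algebra) \<mu>" by blast
  define P where "P = measure_of (topspace X) cells_algebra \<mu>"
  have setsP: "sets P = sets (borel_of X)"
    unfolding P_def using space_closed by (subst sets_measure_of) (auto simp: sigma_sets_cells_algebra)
  have emP: "emeasure P C = ?f C" if "C \<in> cells_algebra" for C
  proof -
    have "emeasure P C = \<mu> C"
    proof (rule emeasure_measure_of[OF P_def space_closed])
      show "positive (sets P) \<mu>" "countably_additive (sets P) \<mu>"
        using \<mu>(2) unfolding setsP sigma_sets_cells_algebra[symmetric] measure_space_def by auto
      show "C \<in> sets P" using cells_algebra_borel[OF that] setsP by simp
    qed
    then show ?thesis using \<mu>(1) that by simp
  qed
  have "space P = topspace X" using sets_eq_imp_space_eq[OF setsP] by simp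
  then have "prob_space P" using emP[OF top] total by (intro prob_spaceI) simp
  then have "P \<in> M1 X"
    unfolding M1_eq_space_prob_algebra[OF polish] space_prob_algebra using setsP by simp
  moreover have "\<forall>C\<in>cells_algebra. measure P C = p C"
    using emP nonneg by (simp add: measure_def)
  ultimately show ?thesis by blast
qed

text \<open>Borel sets of the tight topology are generated by evaluations, and for these the
  intersection-stable generator \<open>cells_algebra\<close> suffices.\<close>

lemma measurable_into_tight_top:
  assumes T: "T \<in> space M \<rightarrow> M1 X"
    and meas: "\<And>C. C \<in> cells_algebra \<Longrightarrow> (\<lambda>x. measure (T x) C) \<in> borel_measurable M"
  shows "T \<in> M \<rightarrow>\<^sub>M borel_of (tight_top X)"
proof -
  interpret algebra "topspace X" cells_algebra by (rule algebra_cells_algebra)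
  have TM: "T x \<in> M1 X" if "x \<in> space M" for x using T that by blast
  have "T \<in> M \<rightarrow>\<^sub>M prob_algebra (borel_of X)"
  proof (rule measurable_prob_algebra_generated[OF sigma_sets_cells_algebra[symmetric]])
    show "Int_stable cells_algebra" by (auto intro!: Int_stableI)
    show "cells_algebra \<subseteq> Pow (topspace X)" by (rule space_closed)
    show "prob_space (T x)" "sets (T x) = sets (borel_of X)" if "x \<in> space M" for x
      using M1_D[OF TM[OF that]] by auto
    fix C assume C: "C \<in> cells_algebra"
    have eq: "emeasure (T x) C = ennreal (measure (T x) C)" if "x \<in> space M" for x
    proof -
      interpret prob_space "T x" using M1_D[OF TM[OF that]] by auto
      show ?thesis by (rule emeasure_eq_measure)
    qed
    show "(\<lambda>x. emeasure (T x) C) \<in> borel_measurable M"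
      by (rule measurable_cong[THEN iffD2, OF eq measurable_compose[OF meas[OF C] measurable_ennreal]])
  qed
  then show ?thesis
    unfolding measurable_cong_sets[OF refl sets_borel_of_tight_top[OF polish basis]] .
qed

lemma proj_measurable_tight_top:
  assumes "\<alpha> \<in> \<A>"
  shows "proj \<alpha> \<in> borel_of (tight_top X) \<rightarrow>\<^sub>M borel_of (simplex_top \<alpha>)"
  unfolding measurable_cong_sets[OF sets_borel_of_tight_top[OF polish basis] refl]
  by (rule proj_measurable[OF polish part[OF assms]])

lemma phi_proj:
  assumes "\<alpha> \<in> \<A>" "\<gamma> \<in> \<A>" "refines \<gamma> \<alpha>" "P \<in> M1 X"
  shows "phi \<alpha> \<gamma> (proj \<gamma> P) = proj \<alpha> P"
proof (rule ext)
  fix A show "phi \<alpha> \<gamma> (proj \<gamma> P) A = proj \<alpha> P A"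
  proof (cases "A \<in> \<alpha>")
    case True
    have "saturated \<gamma> A"
      using saturated_refinement[OF assms(1-3) saturated_cell[OF part[OF assms(1)] True]] .
    then show ?thesis
      using True mass_proj[OF part[OF assms(2)] _ assms(4)] by (simp add: phi_eq_mass) (simp add: proj_def)
  qed (simp add: phi_def proj_def)
qed

text \<open>The cylinder sets form a \<open>\<pi>\<close>-system because \<open>\<A>\<close> is directed, and they generate the Borel
  sets of the tight topology because \<open>\<A>\<close> resolves \<open>X\<close>.\<close>

lemma measure_on_tight_top_unique:
  assumes sets: "sets M = sets (borel_of (tight_top X))" "sets N = sets (borel_of (tight_top X))"
    and prob: "prob_space M"
    and eq: "\<And>\<alpha>. \<alpha> \<in> \<A> \<Longrightarrow> distr M (borel_of (simplex_top \<alpha>)) (proj \<alpha>) = distr N (borel_of (simplex_top \<alpha>)) (proj \<alpha>)"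
  shows "M = N"
proof -
  interpret M: prob_space M by fact
  let ?T = "borel_of (tight_top X)"
  define E where "E = {proj \<alpha> -` S \<inter> M1 X | \<alpha> S. \<alpha> \<in> \<A> \<and> S \<in> sets (borel_of (simplex_top \<alpha>))}"
  have EI: "proj \<alpha> -` S \<inter> M1 X \<in> E" if "\<alpha> \<in> \<A>" "S \<in> sets (borel_of (simplex_top \<alpha>))" for \<alpha> S
    unfolding E_def using that by blast
  have E_sub: "E \<subseteq> Pow (M1 X)" unfolding E_def by blast
  have sp: "space M = M1 X" "space N = M1 X" using sets[THEN sets_eq_imp_space_eq] by auto
  have E_T: "E \<subseteq> sets ?T"
  proof
    fix W assume "W \<in> E"
    then obtain \<alpha> S where W: "\<alpha> \<in> \<A>" "S \<in> sets (borel_of (simplex_top \<alpha>))" "W = proj \<alpha> -` S \<inter> M1 X"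
      unfolding E_def by blast
    show "W \<in> sets ?T" using measurable_sets[OF proj_measurable_tight_top[OF W(1)] W(2)] W(3) by simp
  qed
  have stable: "Int_stable E"
  proof (rule Int_stableI)
    fix V W assume "V \<in> E" "W \<in> E"
    then obtain \<alpha> S \<beta> R where V: "\<alpha> \<in> \<A>" "S \<in> sets (borel_of (simplex_top \<alpha>))" "V = proj \<alpha> -` S \<inter> M1 X"
      and W: "\<beta> \<in> \<A>" "R \<in> sets (borel_of (simplex_top \<beta>))" "W = proj \<beta> -` R \<inter> M1 X"
      unfolding E_def by blast
    obtain \<gamma> where \<gamma>: "\<gamma> \<in> \<A>" "refines \<gamma> \<alpha>" "refines \<gamma> \<beta>" by (rule common_refinement[OF V(1) W(1)])
    \<comment> \<open>Both cylinders are pulled back to the simplex of a common refinement, where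
      their intersection is again a single cylinder.\<close>
    let ?Q = "(phi \<alpha> \<gamma> -` S \<inter> simplexM \<gamma>) \<inter> (phi \<beta> \<gamma> -` R \<inter> simplexM \<gamma>)"
    have "?Q \<in> sets (borel_of (simplex_top \<gamma>))"
      using measurable_sets[OF phi_measurable[OF part[OF V(1)] part[OF \<gamma>(1)] \<gamma>(2)] V(2)]
        measurable_sets[OF phi_measurable[OF part[OF W(1)] part[OF \<gamma>(1)] \<gamma>(3)] W(2)] by auto
    moreover have "V \<inter> W = proj \<gamma> -` ?Q \<inter> M1 X"
      unfolding V(3) W(3)
      using phi_proj[OF V(1) \<gamma>(1,2)] phi_proj[OF W(1) \<gamma>(1,3)] proj_in_simplexM[OF part[OF \<gamma>(1)]] by auto
    ultimately show "V \<inter> W \<in> E" using EI[OF \<gamma>(1)] by metis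
  qed
  \<comment> \<open>Measurability of the identity expresses that the cylinders generate all Borel
    sets: evaluation at a union of cells is a function of one projection.\<close>
  have "(\<lambda>P. P) \<in> sigma (M1 X) E \<rightarrow>\<^sub>M ?T"
  proof (rule measurable_into_tight_top)
    show "(\<lambda>P. P) \<in> space (sigma (M1 X) E) \<rightarrow> M1 X" using E_sub by simp
    fix C assume "C \<in> cells_algebra"
    then obtain \<alpha> where \<alpha>: "\<alpha> \<in> \<A>" "saturated \<alpha> C" by (auto simp: cells_algebra_def)
    have "proj \<alpha> \<in> sigma (M1 X) E \<rightarrow>\<^sub>M borel_of (simplex_top \<alpha>)"
    proof (rule measurableI)
      show "proj \<alpha> P \<in> space (borel_of (simplex_top \<alpha>))" if "P \<in> space (sigma (M1 X) E)" for P
        using that E_sub proj_in_simplexM[OF part[OF \<alpha>(1)]] by simp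
      show "proj \<alpha> -` S \<inter> space (sigma (M1 X) E) \<in> sets (sigma (M1 X) E)"
        if "S \<in> sets (borel_of (simplex_top \<alpha>))" for S
        using EI[OF \<alpha>(1) that] E_sub by simp
    qed
    then have mass: "(\<lambda>P. mass \<alpha> (proj \<alpha> P) C) \<in> borel_measurable (sigma (M1 X) E)"
      by (rule measurable_compose[OF _ mass_measurable])
    have "measure P C = mass \<alpha> (proj \<alpha> P) C" if "P \<in> space (sigma (M1 X) E)" for P
      using that E_sub mass_proj[OF part[OF \<alpha>(1)] \<alpha>(2)] by simp
    then show "(\<lambda>P. measure P C) \<in> borel_measurable (sigma (M1 X) E)"
      by (rule measurable_cong[THEN iffD2, OF _ mass])
  qed
  note id = this
  have gen: "sets ?T = sigma_sets (M1 X) E"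
  proof
    show "sigma_sets (M1 X) E \<subseteq> sets ?T"
      using sets.sigma_sets_subset[OF E_T] by simp
    show "sets ?T \<subseteq> sigma_sets (M1 X) E"
    proof
      fix W assume W: "W \<in> sets ?T"
      then have "W \<subseteq> M1 X" using sets.sets_into_space by force
      then show "W \<in> sigma_sets (M1 X) E"
        using measurable_sets[OF id W] E_sub by (simp add: Int_absorb2)
    qed
  qed
  obtain \<alpha> where \<alpha>: "\<alpha> \<in> \<A>" using directed by (auto simp: directed_refinement_def)
  show ?thesis
  proof (rule measure_eqI_generator_eq[OF stable E_sub, where A = "\<lambda>_. M1 X"])
    show "sets M = sigma_sets (M1 X) E" "sets N = sigma_sets (M1 X) E" using sets gen by auto
    fix W assume "W \<in> E"
    then obtain \<alpha> S where W: "\<alpha> \<in> \<A>" "S \<in> sets (borel_of (simplex_top \<alpha>))" "W = proj \<alpha> -` S \<inter> M1 X"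
      unfolding E_def by blast
    have "proj \<alpha> \<in> M \<rightarrow>\<^sub>M borel_of (simplex_top \<alpha>)" "proj \<alpha> \<in> N \<rightarrow>\<^sub>M borel_of (simplex_top \<alpha>)"
      unfolding measurable_cong_sets[OF sets(1) refl] measurable_cong_sets[OF sets(2) refl]
      by (rule proj_measurable_tight_top[OF W(1)])+
    then show "emeasure M W = emeasure N W"
      using eq[OF W(1)] W(2) unfolding W(3) by (metis emeasure_distr sp)
  next
    have "proj \<alpha> -` simplexM \<alpha> \<inter> M1 X = M1 X" using proj_in_simplexM[OF part[OF \<alpha>]] by blast
    then show "range (\<lambda>_. M1 X) \<subseteq> E"
      using EI[OF \<alpha>, of "simplexM \<alpha>"] sets.top[of "borel_of (simplex_top \<alpha>)"] by auto
  qed auto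
qed

end

subsection \<open>Random measures from coherent systems\<close>

text \<open>Applied to \<open>nat \<Rightarrow> real\<close>, the sample space of the
  extension.\<close>

lemma Polish_space_euclidean: "Polish_space (euclidean :: 'b::polish_space topology)"
proof -
  obtain \<B> :: "'b set set" where \<B>: "countable \<B>" "topological_basis \<B>"
    using ex_countable_basis by blast
  have "second_countable (euclidean :: 'b topology)"
    unfolding second_countable_def
    using \<B> topological_basis_open[OF \<B>(2)] topological_basisE[OF \<B>(2)]
    by (intro exI[of _ \<B>]) (metis open_openin)
  then show ?thesis
    by (simp add: Polish_space_def completely_metrizable_space_euclidean second_countable_imp_separable_space)
qed

locale coherent_system = resolving_partitions X \<U> \<A>
  for X :: "'a topology" and \<U> :: "'a set set" and \<A> :: "'a set set set" +
  fixes Pi_fam :: "'a set set \<Rightarrow> ('a set \<Rightarrow> real) measure"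
  assumes prob_Pi_fam: "\<And>\<alpha>. \<alpha> \<in> \<A> \<Longrightarrow> prob_space (Pi_fam \<alpha>)"
    and sets_Pi_fam: "\<And>\<alpha>. \<alpha> \<in> \<A> \<Longrightarrow> sets (Pi_fam \<alpha>) = sets (borel_of (simplex_top \<alpha>))"
    and coherent: "\<And>\<alpha> \<beta>. \<alpha> \<in> \<A> \<Longrightarrow> \<beta> \<in> \<A> \<Longrightarrow> refines \<beta> \<alpha> \<Longrightarrow>
      Pi_fam \<alpha> = distr (Pi_fam \<beta>) (borel_of (simplex_top \<alpha>)) (phi \<alpha> \<beta>)"
begin

lemma space_Pi_fam: "\<alpha> \<in> \<A> \<Longrightarrow> space (Pi_fam \<alpha>) = simplexM \<alpha>"
  using sets_eq_imp_space_eq[OF sets_Pi_fam] by simp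

lemma measurable_Pi_fam: "\<alpha> \<in> \<A> \<Longrightarrow> measurable (Pi_fam \<alpha>) N = measurable (borel_of (simplex_top \<alpha>)) N"
  by (rule measurable_cong_sets[OF sets_Pi_fam refl])

text \<open>Numbering the coordinates by \<open>nat\<close> places the samples in a Polish type. The
  enumeration may repeat sets when the algebra is finite; only \<open>enum (idx C) = C\<close> is
  used.\<close>

definition enum :: "nat \<Rightarrow> 'a set" where
  "enum = from_nat_into cells_algebra"

definition idx :: "'a set \<Rightarrow> nat" where
  "idx = to_nat_on cells_algebra"

lemma enum_in: "enum i \<in> cells_algebra"
proof -
  interpret algebra "topspace X" cells_algebra by (rule algebra_cells_algebra)
  show ?thesis unfolding enum_def using from_nat_into[of cells_algebra i] empty_sets by blast
qed

lemma enum_idx: "C \<in> cells_algebra \<Longrightarrow> enum (idx C) = C"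
  unfolding enum_def idx_def using countable_cells_algebra by simp

definition masses :: "'a set set \<Rightarrow> nat set \<Rightarrow> ('a set \<Rightarrow> real) \<Rightarrow> nat \<Rightarrow> real" where
  "masses \<alpha> J p = (\<lambda>i\<in>J. mass \<alpha> p (enum i))"

text \<open>An arbitrary sufficiently fine partition; by coherence the resulting marginal does not
  depend on the choice, see \<open>marginal_eq\<close>.\<close>

definition level :: "nat set \<Rightarrow> 'a set set" where
  "level J = (SOME \<alpha>. \<alpha> \<in> \<A> \<and> (\<forall>i\<in>J. saturated \<alpha> (enum i)))"

definition marginal :: "nat set \<Rightarrow> (nat \<Rightarrow> real) measure" where
  "marginal J = distr (Pi_fam (level J)) (PiM J (\<lambda>_. borel)) (masses (level J) J)"

lemma level:
  assumes "finite J"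
  shows "level J \<in> \<A>" "\<forall>i\<in>J. saturated (level J) (enum i)"
proof -
  have "\<exists>\<alpha>. \<alpha> \<in> \<A> \<and> (\<forall>i\<in>J. saturated \<alpha> (enum i))"
    using finite_common_saturation[of "enum ` J"] assms enum_in by auto
  from someI_ex[OF this] show "level J \<in> \<A>" "\<forall>i\<in>J. saturated (level J) (enum i)"
    unfolding level_def by auto
qed

lemma masses_measurable: "\<alpha> \<in> \<A> \<Longrightarrow> masses \<alpha> J \<in> Pi_fam \<alpha> \<rightarrow>\<^sub>M PiM J (\<lambda>_. borel)"
  unfolding masses_def measurable_Pi_fam by (intro measurable_restrict mass_measurable)

text \<open>Coherence writes the coarse law as an image under \<open>phi\<close>, and
  \<open>mass_phi\<close> shows that \<open>phi\<close> leaves the masses of saturated sets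
  unchanged.\<close>

lemma distr_masses_refine:
  assumes "\<alpha> \<in> \<A>" "\<gamma> \<in> \<A>" "refines \<gamma> \<alpha>" and sat: "\<forall>i\<in>J. saturated \<alpha> (enum i)"
  shows "distr (Pi_fam \<alpha>) (PiM J (\<lambda>_. borel)) (masses \<alpha> J) = distr (Pi_fam \<gamma>) (PiM J (\<lambda>_. borel)) (masses \<gamma> J)"
proof -
  have ph: "phi \<alpha> \<gamma> \<in> Pi_fam \<gamma> \<rightarrow>\<^sub>M borel_of (simplex_top \<alpha>)"
    unfolding measurable_Pi_fam[OF assms(2)] by (rule phi_measurable[OF part[OF assms(1)] part[OF assms(2)] assms(3)])
  have ms: "masses \<alpha> J \<in> borel_of (simplex_top \<alpha>) \<rightarrow>\<^sub>M PiM J (\<lambda>_. borel)"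
    using masses_measurable[OF assms(1)] unfolding measurable_Pi_fam[OF assms(1)] .
  have "distr (Pi_fam \<alpha>) (PiM J (\<lambda>_. borel)) (masses \<alpha> J)
      = distr (Pi_fam \<gamma>) (PiM J (\<lambda>_. borel)) (masses \<alpha> J \<circ> phi \<alpha> \<gamma>)"
    unfolding coherent[OF assms(1-3)] by (rule distr_distr[OF ms ph])
  also have "masses \<alpha> J \<circ> phi \<alpha> \<gamma> = masses \<gamma> J"
  proof
    fix p show "(masses \<alpha> J \<circ> phi \<alpha> \<gamma>) p = masses \<gamma> J p"
      using mass_phi[OF part[OF assms(1)] part[OF assms(2)] assms(3)] sat
      by (auto simp: masses_def restrict_def fun_eq_iff)
  qed
  finally show ?thesis .
qed

lemma marginal_eq:
  assumes J: "finite J" and \<alpha>: "\<alpha> \<in> \<A>" "\<forall>i\<in>J. saturated \<alpha> (enum i)"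
  shows "marginal J = distr (Pi_fam \<alpha>) (PiM J (\<lambda>_. borel)) (masses \<alpha> J)"
proof -
  obtain \<gamma> where \<gamma>: "\<gamma> \<in> \<A>" "refines \<gamma> \<alpha>" "refines \<gamma> (level J)"
    by (rule common_refinement[OF \<alpha>(1) level(1)[OF J]])
  show ?thesis
    unfolding marginal_def
    using distr_masses_refine[OF \<alpha>(1) \<gamma>(1,2) \<alpha>(2)] distr_masses_refine[OF level(1)[OF J] \<gamma>(1,3) level(2)[OF J]]
    by simp
qed

text \<open>Kolmogorov consistency: \<open>level H\<close> is fine enough for the indices in
  \<open>J\<close> as well, so both marginals are images of the same law.\<close>

lemma marginal_restrict:
  assumes "J \<subseteq> H" "finite H"
  shows "marginal J = distr (marginal H) (PiM J (\<lambda>_. borel)) (\<lambda>f. restrict f J)"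
proof -
  have J: "finite J" using assms finite_subset by blast
  have "marginal J = distr (Pi_fam (level H)) (PiM J (\<lambda>_. borel)) (masses (level H) J)"
    using level[OF assms(2)] assms(1) by (intro marginal_eq[OF J]) auto
  also have "masses (level H) J = (\<lambda>f. restrict f J) \<circ> masses (level H) H"
    using assms(1) by (auto simp: masses_def fun_eq_iff restrict_def)
  also have "distr (Pi_fam (level H)) (PiM J (\<lambda>_. borel)) \<dots> = distr (marginal H) (PiM J (\<lambda>_. borel)) (\<lambda>f. restrict f J)"
    unfolding marginal_def
    by (rule distr_distr[symmetric, OF measurable_restrict_subset[OF assms(1)] masses_measurable[OF level(1)[OF assms(2)]]])
  finally show ?thesis .
qed

lemma projective_limit:
  "\<exists>L. prob_space L \<and> sets L = sets (borel :: (nat \<Rightarrow> real) measure) \<and>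
    (\<forall>J. finite J \<longrightarrow> distr L (PiM J (\<lambda>_. borel)) (\<lambda>\<omega>. restrict \<omega> J) = marginal J)"
proof -
  have "projective_family (UNIV :: nat set) marginal (\<lambda>_. borel)"
  proof (rule projective_family.intro)
    fix J H :: "nat set"
    show "marginal J = distr (marginal H) (PiM J (\<lambda>_. borel)) (\<lambda>f. restrict f J)"
      if "J \<subseteq> H" "finite H" using marginal_restrict[OF that] .
    show "prob_space (marginal J)" if "finite J"
      unfolding marginal_def
      by (rule prob_space.prob_space_distr[OF prob_Pi_fam masses_measurable]) (rule level(1)[OF that])+
  qed
  then interpret KP: polish_projective "UNIV :: nat set" marginal
    by (rule polish_projective.intro)
  have setsL: "sets KP.lim = sets (PiM UNIV (\<lambda>_. borel))" by (rule KP.sets_lim)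
  have spaceL: "space KP.lim = UNIV" using sets_eq_imp_space_eq[OF setsL] by (simp add: space_PiM)
  have "distr KP.lim (PiM J (\<lambda>_. borel)) (\<lambda>\<omega>. restrict \<omega> J) = marginal J" if J: "finite J" for J
  proof (rule measure_eqI)
    show "sets (distr KP.lim (PiM J (\<lambda>_. borel)) (\<lambda>\<omega>. restrict \<omega> J)) = sets (marginal J)"
      by (simp add: marginal_def)
    fix S assume "S \<in> sets (distr KP.lim (PiM J (\<lambda>_. borel)) (\<lambda>\<omega>. restrict \<omega> J))"
    then have S: "S \<in> sets (PiM J (\<lambda>_. borel :: real measure))" by simp
    have res: "(\<lambda>\<omega>. restrict \<omega> J) \<in> KP.lim \<rightarrow>\<^sub>M PiM J (\<lambda>_. borel)"
      unfolding measurable_cong_sets[OF setsL refl] by (rule measurable_restrict_subset) simp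
    have "emeasure (distr KP.lim (PiM J (\<lambda>_. borel)) (\<lambda>\<omega>. restrict \<omega> J)) S
        = emeasure KP.lim ((\<lambda>\<omega>. restrict \<omega> J) -` S \<inter> space KP.lim)"
      by (rule emeasure_distr[OF res S])
    also have "(\<lambda>\<omega>. restrict \<omega> J) -` S \<inter> space KP.lim = prod_emb UNIV (\<lambda>_. borel) J S"
      using spaceL by (auto simp: prod_emb_def)
    also have "emeasure KP.lim \<dots> = emeasure (marginal J) S"
      using KP.emeasure_lim_emb[OF _ J S] by simp
    finally show "emeasure (distr KP.lim (PiM J (\<lambda>_. borel)) (\<lambda>\<omega>. restrict \<omega> J)) S = emeasure (marginal J) S" .
  qed
  \<comment> \<open>With countably many coordinates the product sigma-algebra is the Borel
    sigma-algebra, so the limit is a Borel law on a Polish space and hence Radon.\<close>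
  moreover have "sets KP.lim = sets borel" using setsL sets_PiM_equal_borel by simp
  ultimately show ?thesis using KP.P.prob_space_axioms by blast
qed

section \<open>Almost sure properties of the projective limit\<close>

context
  fixes L :: "(nat \<Rightarrow> real) measure"
  assumes prob_L: "prob_space L" and sets_L: "sets L = sets borel"
    and marginals_L: "\<And>J. finite J \<Longrightarrow> distr L (PiM J (\<lambda>_. borel)) (\<lambda>\<omega>. restrict \<omega> J) = marginal J"
begin

interpretation L: prob_space L by (rule prob_L)

lemma space_L [simp]: "space L = UNIV"
  using sets_eq_imp_space_eq[OF sets_L] by simp

lemma component_measurable [measurable]: "(\<lambda>\<omega>. \<omega> i) \<in> borel_measurable L"
proof -
  have "(\<lambda>\<omega>::nat \<Rightarrow> real. \<omega> i) \<in> borel_measurable (PiM UNIV (\<lambda>_. borel))" by measurable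
  then show ?thesis
    unfolding measurable_cong_sets[OF sets_L refl] measurable_cong_sets[OF sets_PiM_equal_borel refl] .
qed

lemma greater_measurable: "{\<omega>. \<omega> i > c} \<in> sets L"
  using measurable_sets[OF component_measurable, of "{c<..}" i] by (simp add: vimage_def)

lemma restrict_measurable: "(\<lambda>\<omega>. restrict \<omega> J) \<in> L \<rightarrow>\<^sub>M PiM J (\<lambda>_. borel)"
  by (intro measurable_restrict component_measurable)

text \<open>The hypothesis on \<open>Q\<close> encodes dependence on the coordinates in
  \<open>J\<close> alone; such an event may be computed in the simplex of any partition that
  saturates the sets indexed by \<open>J\<close>.\<close>

lemma finite_dimensional_law:
  assumes J: "finite J" and \<alpha>: "\<alpha> \<in> \<A>" "\<forall>i\<in>J. saturated \<alpha> (enum i)"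
    and S: "{x \<in> space (PiM J (\<lambda>_. borel)). Q x} \<in> sets (PiM J (\<lambda>_. borel :: real measure))"
    and Q: "\<And>\<omega>. Q \<omega> \<longleftrightarrow> Q (restrict \<omega> J)"
  shows "measure L {\<omega>. Q \<omega>} = measure (Pi_fam \<alpha>) {p \<in> simplexM \<alpha>. Q (\<lambda>i. mass \<alpha> p (enum i))}"
proof -
  let ?S = "{x \<in> space (PiM J (\<lambda>_. borel :: real measure)). Q x}"
  have "measure L {\<omega>. Q \<omega>} = measure L ((\<lambda>\<omega>. restrict \<omega> J) -` ?S \<inter> space L)"
    using Q by (auto simp: space_PiM intro!: arg_cong[where f = "measure L"])
  also have "\<dots> = measure (distr L (PiM J (\<lambda>_. borel)) (\<lambda>\<omega>. restrict \<omega> J)) ?S"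
    by (rule measure_distr[symmetric, OF restrict_measurable S])
  also have "\<dots> = measure (distr (Pi_fam \<alpha>) (PiM J (\<lambda>_. borel)) (masses \<alpha> J)) ?S"
    by (simp only: marginals_L[OF J] marginal_eq[OF J \<alpha>])
  also have "\<dots> = measure (Pi_fam \<alpha>) (masses \<alpha> J -` ?S \<inter> space (Pi_fam \<alpha>))"
    by (rule measure_distr[OF masses_measurable[OF \<alpha>(1)] S])
  also have "masses \<alpha> J -` ?S \<inter> space (Pi_fam \<alpha>) = {p \<in> simplexM \<alpha>. Q (\<lambda>i. mass \<alpha> p (enum i))}"
  proof -
    have "Q (masses \<alpha> J p) \<longleftrightarrow> Q (\<lambda>i. mass \<alpha> p (enum i))" for p
      unfolding masses_def by (rule Q[symmetric])
    moreover have "masses \<alpha> J p \<in> space (PiM J (\<lambda>_. borel :: real measure))" for p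
      by (simp add: masses_def space_PiM)
    ultimately show ?thesis using space_Pi_fam[OF \<alpha>(1)] by auto
  qed
  finally show ?thesis .
qed

lemma AE_finite_dimensional:
  assumes J: "finite J" and \<alpha>: "\<alpha> \<in> \<A>" "\<forall>i\<in>J. saturated \<alpha> (enum i)"
    and S: "{x \<in> space (PiM J (\<lambda>_. borel)). Q x} \<in> sets (PiM J (\<lambda>_. borel :: real measure))"
    and Q: "\<And>\<omega>. Q \<omega> \<longleftrightarrow> Q (restrict \<omega> J)"
    and sure: "\<And>p. p \<in> simplexM \<alpha> \<Longrightarrow> Q (\<lambda>i. mass \<alpha> p (enum i))"
  shows "AE \<omega> in L. Q \<omega>"
proof -
  interpret A: prob_space "Pi_fam \<alpha>" by (rule prob_Pi_fam[OF \<alpha>(1)])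
  have "(\<lambda>\<omega>. restrict \<omega> J) -` {x \<in> space (PiM J (\<lambda>_. borel :: real measure)). Q x} \<inter> space L = {\<omega>. Q \<omega>}"
    using Q by (auto simp: space_PiM)
  then have "{\<omega>. Q \<omega>} \<in> sets L" using measurable_sets[OF restrict_measurable S] by simp
  moreover have "{p \<in> simplexM \<alpha>. Q (\<lambda>i. mass \<alpha> p (enum i))} = space (Pi_fam \<alpha>)"
    using sure space_Pi_fam[OF \<alpha>(1)] by auto
  then have "measure L {\<omega>. Q \<omega>} = 1"
    using finite_dimensional_law[OF J \<alpha> S Q] A.prob_space by simp
  ultimately show ?thesis using L.prob_eq_1[of "{\<omega>. Q \<omega>}"] by simp
qed

lemma AE_nonneg: "AE \<omega> in L. \<forall>i. 0 \<le> \<omega> i"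
proof -
  have "AE \<omega> in L. 0 \<le> \<omega> i" for i
  proof -
    obtain \<alpha> where \<alpha>: "\<alpha> \<in> \<A>" "\<forall>i\<in>{i}. saturated \<alpha> (enum i)" using level[of "{i}"] by auto
    show ?thesis by (rule AE_finite_dimensional[OF _ \<alpha>]) (auto simp: mass_nonneg)
  qed
  then show ?thesis by (simp add: AE_all_countable)
qed

lemma AE_total: "AE \<omega> in L. \<omega> (idx (topspace X)) = 1"
proof -
  interpret algebra "topspace X" cells_algebra by (rule algebra_cells_algebra)
  let ?i = "idx (topspace X)"
  obtain \<alpha> where \<alpha>: "\<alpha> \<in> \<A>" "\<forall>i\<in>{?i}. saturated \<alpha> (enum i)" using level[of "{?i}"] by auto
  show ?thesis
    by (rule AE_finite_dimensional[OF _ \<alpha>]) (auto simp: enum_idx[OF top] mass_topspace[OF part[OF \<alpha>(1)]])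
qed

lemma AE_additive:
  "AE \<omega> in L. \<forall>i j k. enum i \<inter> enum j = {} \<longrightarrow> enum k = enum i \<union> enum j \<longrightarrow> \<omega> k = \<omega> i + \<omega> j"
proof -
  \<comment> \<open>The union carries its own index \<open>k\<close>, so additivity is a family of
    statements over triples of naturals, each involving three coordinates; countably many null sets
    are discarded.\<close>
  have "AE \<omega> in L. enum i \<inter> enum j = {} \<longrightarrow> enum k = enum i \<union> enum j \<longrightarrow> \<omega> k = \<omega> i + \<omega> j" for i j k
  proof (cases "enum i \<inter> enum j = {} \<and> enum k = enum i \<union> enum j")
    case True
    obtain \<alpha> where \<alpha>: "\<alpha> \<in> \<A>" "\<forall>l\<in>{i, j, k}. saturated \<alpha> (enum l)" using level[of "{i, j, k}"] by blast
    have "AE \<omega> in L. \<omega> k = \<omega> i + \<omega> j"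
      by (rule AE_finite_dimensional[OF _ \<alpha>])
        (use True \<alpha>(2) mass_Un[OF part[OF \<alpha>(1)]] in auto)
    then show ?thesis by eventually_elim simp
  qed auto
  then show ?thesis by (simp add: AE_all_countable)
qed

text \<open>With finitely many indices, everything happens on one partition: cells inside a set that
  misses \<open>K\<close> are disjoint from the cells that meet \<open>K\<close>, so mass above
  \<delta> on such a set pushes the latter sum below 1 - \<delta>. Letting \<open>N\<close> grow
  turns the strict bound into a weak one.\<close>

lemma tail_probability:
  assumes K: "\<forall>\<alpha>\<in>\<A>. measure (Pi_fam \<alpha>)
      {p \<in> simplexM \<alpha>. (\<Sum>A\<in>{A\<in>\<alpha>. A \<inter> K \<noteq> {}}. p A) < 1 - \<delta>} < \<epsilon>"
  shows "measure L {\<omega>. \<exists>i. enum i \<inter> K = {} \<and> \<omega> i > \<delta>} \<le> \<epsilon>"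
proof -
  define B where "B N = {\<omega>. \<exists>i\<in>{..N}. enum i \<inter> K = {} \<and> \<omega> i > \<delta>}" for N :: nat
  have B_sets: "B N \<in> sets L" for N
  proof -
    have "B N = (\<Union>i\<in>{i\<in>{..N}. enum i \<inter> K = {}}. {\<omega>. \<omega> i > \<delta>})" unfolding B_def by auto
    also have "\<dots> \<in> sets L" by (intro sets.finite_UN greater_measurable) auto
    finally show ?thesis .
  qed
  have "incseq B" unfolding B_def by (fastforce simp: incseq_def)
  moreover have UB: "(\<Union>N. B N) = {\<omega>. \<exists>i. enum i \<inter> K = {} \<and> \<omega> i > \<delta>}" unfolding B_def by blast
  ultimately have lim: "(\<lambda>N. measure L (B N)) \<longlonglongrightarrow> measure L {\<omega>. \<exists>i. enum i \<inter> K = {} \<and> \<omega> i > \<delta>}"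
    using L.finite_Lim_measure_incseq[of B] B_sets by auto
  have "measure L (B N) \<le> \<epsilon>" for N
  proof -
    obtain \<alpha> where \<alpha>: "\<alpha> \<in> \<A>" "\<forall>i\<in>{..N}. saturated \<alpha> (enum i)" using level[of "{..N}"] by auto
    interpret A: prob_space "Pi_fam \<alpha>" by (rule prob_Pi_fam[OF \<alpha>(1)])
    have fin: "finite \<alpha>" using part[OF \<alpha>(1)] by (simp add: is_partition_def)
    let ?hull = "{A\<in>\<alpha>. A \<inter> K \<noteq> {}}"
    let ?bad = "{p \<in> simplexM \<alpha>. (\<Sum>A\<in>?hull. p A) < 1 - \<delta>}"
    have "(\<lambda>p. \<Sum>A\<in>?hull. p A) \<in> borel_measurable (borel_of (simplex_top \<alpha>))"
      by (intro borel_measurable_sum simplex_coordinate_measurable) simp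
    then have "(\<lambda>p. \<Sum>A\<in>?hull. p A) -` {..<1 - \<delta>} \<inter> space (borel_of (simplex_top \<alpha>)) \<in> sets (borel_of (simplex_top \<alpha>))"
      by (rule measurable_sets) simp
    also have "(\<lambda>p. \<Sum>A\<in>?hull. p A) -` {..<1 - \<delta>} \<inter> space (borel_of (simplex_top \<alpha>)) = ?bad" by auto
    finally have bad: "?bad \<in> sets (Pi_fam \<alpha>)" unfolding sets_Pi_fam[OF \<alpha>(1)] .
    have "measure L (B N)
        = measure (Pi_fam \<alpha>) {p \<in> simplexM \<alpha>. \<exists>i\<in>{..N}. enum i \<inter> K = {} \<and> mass \<alpha> p (enum i) > \<delta>}"
      unfolding B_def by (rule finite_dimensional_law[OF _ \<alpha>]) auto
    also have "\<dots> \<le> measure (Pi_fam \<alpha>) ?bad"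
    proof (rule A.finite_measure_mono[OF _ bad], rule subsetI)
      fix p assume "p \<in> {p \<in> simplexM \<alpha>. \<exists>i\<in>{..N}. enum i \<inter> K = {} \<and> mass \<alpha> p (enum i) > \<delta>}"
      then obtain i where p: "p \<in> simplexM \<alpha>" and i: "enum i \<inter> K = {}" "mass \<alpha> p (enum i) > \<delta>" by auto
      have "(\<Sum>A\<in>?hull. p A) + mass \<alpha> p (enum i) = sum p (?hull \<union> {A\<in>\<alpha>. A \<subseteq> enum i})"
        unfolding mass_def using fin i(1) by (intro sum.union_disjoint[symmetric]) auto
      also have "\<dots> \<le> sum p \<alpha>" using fin p by (intro sum_mono2) (auto simp: simplexM_def)
      also have "\<dots> = 1" using p by (simp add: simplexM_def)
      finally show "p \<in> ?bad" using p i(2) by simp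
    qed
    also have "\<dots> < \<epsilon>" using K \<alpha>(1) by blast
    finally show ?thesis by simp
  qed
  then show ?thesis using lim by (intro LIMSEQ_le_const2) auto
qed

text \<open>For fixed \<open>m\<close>, the compact set \<open>K n\<close> fails with probability at
  most \<open>1 / real (Suc n)\<close>, so almost no sample is failed by all of them. Which
  \<open>K n\<close> succeeds varies with the sample.\<close>

lemma AE_tight:
  assumes tight: "\<forall>\<epsilon>>0. \<forall>\<delta>>0. \<exists>K. compactin (hat_top X \<U>) K \<and> (\<forall>\<alpha>\<in>\<A>. measure (Pi_fam \<alpha>)
      {p \<in> simplexM \<alpha>. (\<Sum>A\<in>{A\<in>\<alpha>. A \<inter> K \<noteq> {}}. p A) < 1 - \<delta>} < \<epsilon>)"
  shows "AE \<omega> in L. \<forall>m::nat. \<exists>K. compactin (hat_top X \<U>) K \<and> (\<forall>i. enum i \<inter> K = {} \<longrightarrow> \<omega> i \<le> 1 / real (Suc m))"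
proof -
  have "AE \<omega> in L. \<exists>K. compactin (hat_top X \<U>) K \<and> (\<forall>i. enum i \<inter> K = {} \<longrightarrow> \<omega> i \<le> 1 / real (Suc m))" for m
  proof -
    let ?\<delta> = "1 / real (Suc m)"
    have "\<exists>K. compactin (hat_top X \<U>) K \<and> (\<forall>\<alpha>\<in>\<A>. measure (Pi_fam \<alpha>)
      {p \<in> simplexM \<alpha>. (\<Sum>A\<in>{A\<in>\<alpha>. A \<inter> K \<noteq> {}}. p A) < 1 - ?\<delta>} < 1 / real (Suc n))" for n
      using tight by simp
    then have "\<exists>K. \<forall>n. compactin (hat_top X \<U>) (K n) \<and> (\<forall>\<alpha>\<in>\<A>. measure (Pi_fam \<alpha>)
      {p \<in> simplexM \<alpha>. (\<Sum>A\<in>{A\<in>\<alpha>. A \<inter> K n \<noteq> {}}. p A) < 1 - ?\<delta>} < 1 / real (Suc n))"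
      by (intro choice allI)
    then obtain K where K: "\<And>n. compactin (hat_top X \<U>) (K n)"
        "\<And>n. \<forall>\<alpha>\<in>\<A>. measure (Pi_fam \<alpha>)
          {p \<in> simplexM \<alpha>. (\<Sum>A\<in>{A\<in>\<alpha>. A \<inter> K n \<noteq> {}}. p A) < 1 - ?\<delta>} < 1 / real (Suc n)" by auto
    define D where "D n = {\<omega>. \<exists>i. enum i \<inter> K n = {} \<and> \<omega> i > ?\<delta>}" for n
    have D_sets: "D n \<in> sets L" for n
    proof -
      have "D n = (\<Union>i\<in>{i. enum i \<inter> K n = {}}. {\<omega>. \<omega> i > ?\<delta>})" unfolding D_def by auto
      also have "\<dots> \<in> sets L" by (intro sets.countable_UN'' greater_measurable) auto
      finally show ?thesis .
    qed
    have "measure L (\<Inter>n. D n) \<le> 1 / real (Suc n)" for n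
    proof -
      have "measure L (\<Inter>n. D n) \<le> measure L (D n)" using D_sets by (intro L.finite_measure_mono) auto
      also have "\<dots> \<le> 1 / real (Suc n)" unfolding D_def by (rule tail_probability[OF K(2)])
      finally show ?thesis .
    qed
    then have "measure L (\<Inter>n. D n) \<le> 0"
      using LIMSEQ_inverse_real_of_nat by (intro LIMSEQ_le_const) (auto simp: inverse_eq_divide)
    then have "(\<Inter>n. D n) \<in> null_sets L"
      using D_sets by (intro null_setsI) (auto simp: L.emeasure_eq_measure measure_le_0_iff)
    then show ?thesis
    proof (rule AE_I')
      \<comment> \<open>The exceptional set quantifies over all compact sets and is not shown to be
        measurable; it suffices that it lies in a null set.\<close>
      show "{\<omega> \<in> space L. \<not> (\<exists>K. compactin (hat_top X \<U>) K \<and> (\<forall>i. enum i \<inter> K = {} \<longrightarrow> \<omega> i \<le> ?\<delta>))} \<subseteq> (\<Inter>n. D n)"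
        unfolding D_def using K(1) by (auto simp: not_le)
    qed
  qed
  then show ?thesis by (simp add: AE_all_countable)
qed

lemma random_measure_exists:
  assumes tight: "\<forall>\<epsilon>>0. \<forall>\<delta>>0. \<exists>K. compactin (hat_top X \<U>) K \<and> (\<forall>\<alpha>\<in>\<A>. measure (Pi_fam \<alpha>)
      {p \<in> simplexM \<alpha>. (\<Sum>A\<in>{A\<in>\<alpha>. A \<inter> K \<noteq> {}}. p A) < 1 - \<delta>} < \<epsilon>)"
  shows "\<exists>T. T \<in> L \<rightarrow>\<^sub>M borel_of (tight_top X) \<and>
    (AE \<omega> in L. \<forall>C\<in>cells_algebra. measure (T \<omega>) C = \<omega> (idx C))"
proof -
  interpret algebra "topspace X" cells_algebra by (rule algebra_cells_algebra)
  let ?good = "\<lambda>\<omega>. \<exists>P\<in>M1 X. \<forall>C\<in>cells_algebra. measure P C = \<omega> (idx C)"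
  have "AE \<omega> in L. ?good \<omega>"
    using AE_nonneg AE_total AE_additive AE_tight[OF tight]
  proof eventually_elim
    case (elim \<omega>)
    show ?case
    proof (rule tight_charge_extends)
      show "\<omega> (idx (C \<union> D)) = \<omega> (idx C) + \<omega> (idx D)"
        if "C \<in> cells_algebra" "D \<in> cells_algebra" "C \<inter> D = {}" for C D
        using elim(3) that enum_idx Un by metis
      fix \<delta> :: real assume "\<delta> > 0"
      then obtain m where m: "1 / real (Suc m) < \<delta>" using nat_approx_posE by blast
      obtain K where K: "compactin (hat_top X \<U>) K" "\<forall>i. enum i \<inter> K = {} \<longrightarrow> \<omega> i \<le> 1 / real (Suc m)"
        using elim(4) by blast
      have "\<omega> (idx C) \<le> \<delta>" if "C \<in> cells_algebra" "C \<inter> K = {}" for C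
        using K(2) enum_idx[OF that(1)] that(2) m by (metis less_imp_le order_trans)
      then show "\<exists>K. compactin (hat_top X \<U>) K \<and> (\<forall>C\<in>cells_algebra. C \<inter> K = {} \<longrightarrow> \<omega> (idx C) \<le> \<delta>)"
        using K(1) by blast
    qed (use elim in auto)
  qed
  then obtain N where N: "{\<omega> \<in> space L. \<not> ?good \<omega>} \<subseteq> N" "emeasure L N = 0" "N \<in> sets L"
    by (rule AE_E)
  \<comment> \<open>A null set is not the whole space; any sample outside it supplies a default
    value \<open>P0\<close> in \<open>M1 X\<close>.\<close>
  have "N \<noteq> space L" using N(2) L.emeasure_space_1 by auto
  then obtain \<omega>0 where "\<omega>0 \<notin> N" by auto
  then obtain P0 where P0: "P0 \<in> M1 X" using N(1) by auto
  \<comment> \<open>Choosing by \<open>SOME\<close> does no harm to measurability: off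
    \<open>N\<close> the values of \<open>T \<omega>\<close> on the algebra are the coordinates of
    \<omega>, on \<open>N\<close> they are constant.\<close>
  define T where "T \<omega> = (if \<omega> \<in> N then P0 else (SOME P. P \<in> M1 X \<and> (\<forall>C\<in>cells_algebra. measure P C = \<omega> (idx C))))" for \<omega>
  have T: "T \<omega> \<in> M1 X \<and> (\<forall>C\<in>cells_algebra. measure (T \<omega>) C = \<omega> (idx C))" if "\<omega> \<notin> N" for \<omega>
  proof -
    have "?good \<omega>"
    proof (rule ccontr)
      assume "\<not> ?good \<omega>"
      then have "\<omega> \<in> N" by (intro subsetD[OF N(1)]) simp
      with that show False by simp
    qed
    then have "\<exists>P. P \<in> M1 X \<and> (\<forall>C\<in>cells_algebra. measure P C = \<omega> (idx C))" by blast
    from someI_ex[OF this] show ?thesis using that by (simp add: T_def)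
  qed
  have "T \<in> L \<rightarrow>\<^sub>M borel_of (tight_top X)"
  proof (rule measurable_into_tight_top)
    show "T \<in> space L \<rightarrow> M1 X" using T P0 by (auto simp: T_def)
    fix C assume C: "C \<in> cells_algebra"
    have "measure (T \<omega>) C = (if \<omega> \<in> N then measure P0 C else \<omega> (idx C))" for \<omega>
      using T[of \<omega>] C by (auto simp: T_def)
    then show "(\<lambda>\<omega>. measure (T \<omega>) C) \<in> borel_measurable L"
      using N(3) by simp
  qed
  moreover have "AE \<omega> in L. \<forall>C\<in>cells_algebra. measure (T \<omega>) C = \<omega> (idx C)"
    using N T by (intro AE_I'[of N]) auto
  ultimately show ?thesis by blast
qed

text \<open>The mass of a cell is its own coordinate, so relabelling the indices
  \<open>idx A\<close> by the cells \<open>A\<close> recovers the given law, viewed in the ambient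
  product space.\<close>

lemma distr_coordinates:
  assumes \<alpha>: "\<alpha> \<in> \<A>"
  shows "distr L (PiM \<alpha> (\<lambda>_. borel)) (\<lambda>\<omega>. \<lambda>A\<in>\<alpha>. \<omega> (idx A)) = distr (Pi_fam \<alpha>) (PiM \<alpha> (\<lambda>_. borel)) (\<lambda>p. p)"
proof -
  let ?J = "idx ` \<alpha>" and ?r = "\<lambda>x. \<lambda>A\<in>\<alpha>. x (idx A) :: real"
  have J: "finite ?J" using part[OF \<alpha>] by (simp add: is_partition_def)
  have enum: "enum (idx A) = A" if "A \<in> \<alpha>" for A using enum_idx cell_in_cells_algebra[OF \<alpha> that] by blast
  have sat: "\<forall>i\<in>?J. saturated \<alpha> (enum i)" using enum saturated_cell[OF part[OF \<alpha>]] by auto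
  have r: "?r \<in> PiM ?J (\<lambda>_. borel) \<rightarrow>\<^sub>M PiM \<alpha> (\<lambda>_. borel)"
    by (intro measurable_restrict measurable_component_singleton) auto
  have "distr L (PiM \<alpha> (\<lambda>_. borel)) ?r = distr L (PiM \<alpha> (\<lambda>_. borel)) (?r \<circ> (\<lambda>\<omega>. restrict \<omega> ?J))"
    by (intro arg_cong[where f = "distr L _"]) (auto simp: fun_eq_iff restrict_def)
  also have "\<dots> = distr (distr L (PiM ?J (\<lambda>_. borel)) (\<lambda>\<omega>. restrict \<omega> ?J)) (PiM \<alpha> (\<lambda>_. borel)) ?r"
    by (rule distr_distr[symmetric, OF r restrict_measurable])
  also have "\<dots> = distr (distr (Pi_fam \<alpha>) (PiM ?J (\<lambda>_. borel)) (masses \<alpha> ?J)) (PiM \<alpha> (\<lambda>_. borel)) ?r"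
    by (simp only: marginals_L[OF J] marginal_eq[OF J \<alpha> sat])
  also have "\<dots> = distr (Pi_fam \<alpha>) (PiM \<alpha> (\<lambda>_. borel)) (?r \<circ> masses \<alpha> ?J)"
    by (rule distr_distr[OF r masses_measurable[OF \<alpha>]])
  also have "\<dots> = distr (Pi_fam \<alpha>) (PiM \<alpha> (\<lambda>_. borel)) (\<lambda>p. p)"
  proof (rule distr_cong)
    fix p assume "p \<in> space (Pi_fam \<alpha>)"
    then have "p \<in> extensional \<alpha>" using space_Pi_fam[OF \<alpha>] by (simp add: simplexM_def)
    then show "(?r \<circ> masses \<alpha> ?J) p = p"
      using enum mass_cell[OF part[OF \<alpha>]] by (auto simp: masses_def fun_eq_iff extensional_def)
  qed auto
  finally show ?thesis .
qed

lemma distr_random_measure_proj: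
  assumes \<alpha>: "\<alpha> \<in> \<A>" and T: "T \<in> L \<rightarrow>\<^sub>M borel_of (tight_top X)"
    and ae: "AE \<omega> in L. \<forall>C\<in>cells_algebra. measure (T \<omega>) C = \<omega> (idx C)"
  shows "distr (distr L (borel_of (tight_top X)) T) (borel_of (simplex_top \<alpha>)) (proj \<alpha>) = Pi_fam \<alpha>"
proof (rule measure_eqI)
  have fin: "finite \<alpha>" using part[OF \<alpha>] by (simp add: is_partition_def)
  let ?r = "\<lambda>x. \<lambda>A\<in>\<alpha>. x (idx A) :: real"
  note proj = proj_measurable_tight_top[OF \<alpha>]
  fix S assume "S \<in> sets (distr (distr L (borel_of (tight_top X)) T) (borel_of (simplex_top \<alpha>)) (proj \<alpha>))"
  then have S: "S \<in> sets (borel_of (simplex_top \<alpha>))" by simp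
  then have S': "S \<in> sets (PiM \<alpha> (\<lambda>_. borel))"
    using sets_borel_of_simplex_top_subset[OF fin] simplexM_in_sets_PiM[OF fin]
    by (auto simp: sets_restrict_space_iff)
  have r: "?r \<in> L \<rightarrow>\<^sub>M PiM \<alpha> (\<lambda>_. borel)" by (intro measurable_restrict component_measurable)
  have id: "(\<lambda>p. p) \<in> Pi_fam \<alpha> \<rightarrow>\<^sub>M PiM \<alpha> (\<lambda>_. borel)"
    unfolding measurable_Pi_fam[OF \<alpha>]
    by (rule measurable_PiM_single') (auto simp: simplexM_def PiE_def)
  have "emeasure (distr (distr L (borel_of (tight_top X)) T) (borel_of (simplex_top \<alpha>)) (proj \<alpha>)) S
      = emeasure L ((proj \<alpha> \<circ> T) -` S \<inter> space L)"
    unfolding distr_distr[OF proj T] by (rule emeasure_distr[OF measurable_comp[OF T proj] S])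
  \<comment> \<open>Almost surely the projection of the random measure is the vector of sample
    coordinates. The latter need not lie in the simplex everywhere, hence the comparison in the
    ambient product.\<close>
  also have "\<dots> = emeasure L (?r -` S \<inter> space L)"
  proof (rule emeasure_eq_AE)
    show "AE \<omega> in L. \<omega> \<in> (proj \<alpha> \<circ> T) -` S \<inter> space L \<longleftrightarrow> \<omega> \<in> ?r -` S \<inter> space L"
      using ae
    proof eventually_elim
      case (elim \<omega>)
      have "proj \<alpha> (T \<omega>) = ?r \<omega>"
        using elim cell_in_cells_algebra[OF \<alpha>] by (auto simp: proj_def restrict_def)
      then show ?case by simp
    qed
  qed (use measurable_sets[OF measurable_comp[OF T proj] S] measurable_sets[OF r S'] in auto)
  also have "\<dots> = emeasure (distr L (PiM \<alpha> (\<lambda>_. borel)) ?r) S"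
    by (rule emeasure_distr[symmetric, OF r S'])
  also have "\<dots> = emeasure (Pi_fam \<alpha>) ((\<lambda>p. p) -` S \<inter> space (Pi_fam \<alpha>))"
    unfolding distr_coordinates[OF \<alpha>] by (rule emeasure_distr[OF id S'])
  also have "(\<lambda>p. p) -` S \<inter> space (Pi_fam \<alpha>) = S"
    using sets.sets_into_space[OF S] space_Pi_fam[OF \<alpha>] by auto
  finally show "emeasure (distr (distr L (borel_of (tight_top X)) T) (borel_of (simplex_top \<alpha>)) (proj \<alpha>)) S
      = emeasure (Pi_fam \<alpha>) S" .
qed (simp add: sets_Pi_fam[OF \<alpha>])

end

lemma radon_prob_exists:
  assumes tight: "\<forall>\<epsilon>>0. \<forall>\<delta>>0. \<exists>K. compactin (hat_top X \<U>) K \<and> (\<forall>\<alpha>\<in>\<A>. measure (Pi_fam \<alpha>)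
      {p \<in> simplexM \<alpha>. (\<Sum>A\<in>{A\<in>\<alpha>. A \<inter> K \<noteq> {}}. p A) < 1 - \<delta>} < \<epsilon>)"
  shows "\<exists>Pi. radon_prob (tight_top X) Pi \<and>
    (\<forall>\<alpha>\<in>\<A>. distr Pi (borel_of (simplex_top \<alpha>)) (proj \<alpha>) = Pi_fam \<alpha>)"
proof -
  have metr: "metrizable_space X"
    using polish by (simp add: Polish_space_def completely_metrizable_imp_metrizable_space)
  obtain L :: "(nat \<Rightarrow> real) measure" where L: "prob_space L" "sets L = sets borel"
      "\<And>J. finite J \<Longrightarrow> distr L (PiM J (\<lambda>_. borel)) (\<lambda>\<omega>. restrict \<omega> J) = marginal J"
    using projective_limit by blast
  obtain T where T: "T \<in> L \<rightarrow>\<^sub>M borel_of (tight_top X)"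
      "AE \<omega> in L. \<forall>C\<in>cells_algebra. measure (T \<omega>) C = \<omega> (idx C)"
    using random_measure_exists[OF L tight] by blast
  have "radon_prob euclidean L"
    using L by (intro Polish_imp_radon_prob Polish_space_euclidean) simp_all
  then have "radon_prob (tight_top X) (distr L (borel_of (tight_top X)) T)"
    by (rule radon_prob_distr[OF _ _ countable_tight_subbase[OF basis] tight_top_eq_generated[OF metr basis]
          Hausdorff_tight_top[OF metr] T(1)]) simp
  then show ?thesis using distr_random_measure_proj[OF L _ T] by blast
qed

end

subsection \<open>Tightness of the projections\<close>

text \<open>The subbasic sets of the refinement are open or closed in \<open>X\<close>, so the
  identity from \<open>X\<close> to the refinement is Borel. Lusin makes it continuous on a large
  compact set, which is therefore compact in the finer topology too.\<close>

lemma compactin_hat_top_approximation: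
  assumes pol: "Polish_space X" and basis: "countable_basis X \<U>"
    and prob: "prob_space m" "sets m = sets (borel_of X)" and e: "(e::real) > 0"
  shows "\<exists>K. compactin (hat_top X \<U>) K \<and> K \<in> sets m \<and> measure m (space m - K) < e"
proof -
  have metr: "metrizable_space X"
    using pol by (simp add: Polish_space_def completely_metrizable_imp_metrizable_space)
  have Uo: "openin X U" if "U \<in> \<U>" for U using basis that by (simp add: countable_basis_def)
  define S where "S = {topspace X} \<union> \<U> \<union> {topspace X - U | U. U \<in> \<U>}"
  have "countable S"
    using basis by (simp add: S_def countable_basis_def setcompr_eq_image)
  moreover have "(\<lambda>x. x) -` s \<inter> topspace X \<in> sets m" if "s \<in> S" for s
  proof -
    have "s \<in> sets (borel_of X)"
      using that unfolding S_def
      by (auto intro: openin_in_sets_borel_of[OF Uo] closedin_in_sets_borel_of[OF closedin_diff[OF closedin_topspace Uo]]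
          openin_in_sets_borel_of[OF openin_topspace])
    then show ?thesis using prob(2) sets.sets_into_space[of s m] sets_eq_imp_space_eq[OF prob(2)]
      by (simp add: Int_absorb2)
  qed
  moreover have "(\<lambda>x. x) \<in> topspace X \<rightarrow> \<Union>S" unfolding S_def by auto
  ultimately have "\<exists>K. compactin X K \<and> K \<subseteq> space m \<and> K \<in> sets m \<and> measure m (space m - K) < e \<and>
      continuous_map (subtopology X K) (topology_generated_by S) (\<lambda>x. x)"
    by (rule Lusin_compact[OF Polish_imp_radon_prob[OF pol prob] metrizable_imp_Hausdorff_space[OF metr] _ _ _ sets.top e])
  then obtain K where K: "compactin X K" "K \<in> sets m" "measure m (space m - K) < e"
      "continuous_map (subtopology X K) (topology_generated_by S) (\<lambda>x. x)"
    by auto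
  have "compactin (hat_top X \<U>) ((\<lambda>x. x) ` K)"
    using compactin_continuous_subtopology_image[OF K(1,4)] unfolding hat_top_def S_def .
  then show ?thesis using K by auto
qed

lemma (in coherent_system) projections_tight:
  assumes rad: "radon_prob (tight_top X) M"
    and proj: "\<And>\<alpha>. \<alpha> \<in> \<A> \<Longrightarrow> distr M (borel_of (simplex_top \<alpha>)) (proj \<alpha>) = Pi_fam \<alpha>"
    and pos: "(\<epsilon>::real) > 0" "(\<delta>::real) > 0"
  shows "\<exists>K. compactin (hat_top X \<U>) K \<and> (\<forall>\<alpha>\<in>\<A>. measure (Pi_fam \<alpha>)
      {p \<in> simplexM \<alpha>. (\<Sum>A\<in>{A\<in>\<alpha>. A \<inter> K \<noteq> {}}. p A) < 1 - \<delta>} < \<epsilon>)"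
proof -
  interpret M: prob_space M using rad by (simp add: radon_prob_def)
  have setsM: "sets M = sets (borel_of (tight_top X))" using rad by (simp add: radon_prob_def)
  have spaceM: "space M = M1 X" using sets_eq_imp_space_eq[OF setsM] by simp
  have M_prob: "M \<in> space (prob_algebra (prob_algebra (borel_of X)))"
    unfolding space_prob_algebra using setsM sets_borel_of_tight_top[OF polish basis] M.prob_space_axioms by simp
  have id: "(\<lambda>P. P) \<in> prob_algebra (borel_of X) \<rightarrow>\<^sub>M prob_algebra (borel_of X)" by simp
  \<comment> \<open>the mean measure of the random measure\<close>
  define m where "m = bind M (\<lambda>P. P)"
  have prob_m: "prob_space m" unfolding m_def by (rule prob_space_bind'[OF M_prob id])
  have sets_m: "sets m = sets (borel_of X)" unfolding m_def by (rule sets_bind'[OF M_prob id])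
  have space_m: "space m = topspace X" using sets_eq_imp_space_eq[OF sets_m] by simp
  interpret m: prob_space m by (rule prob_m)
  \<comment> \<open>The product comes from Markov's inequality: the event that \<open>P\<close> puts
    mass at least \<delta> off \<open>K\<close> has probability at most the mean mass off
    \<open>K\<close> divided by \<delta>.\<close>
  obtain K where K: "compactin (hat_top X \<U>) K" "K \<in> sets m" "measure m (topspace X - K) < \<epsilon> * \<delta>"
    using compactin_hat_top_approximation[OF polish basis prob_m sets_m, of "\<epsilon> * \<delta>"] pos
    unfolding space_m by auto
  have K': "K \<in> sets (borel_of X)" using K(2) sets_m by simp
  have Kc: "topspace X - K \<in> sets (borel_of X)" using K' by (metis sets.compl_sets space_borel_of)
  let ?u = "\<lambda>P. emeasure P (topspace X - K)"
  have u: "?u \<in> borel_measurable M"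
    unfolding measurable_cong_sets[OF setsM refl] measurable_cong_sets[OF sets_borel_of_tight_top[OF polish basis] refl]
    using Kc by (intro measurable_compose[OF measurable_prob_algebraD[OF id] measurable_emeasure_subprob_algebra])
  \<comment> \<open>This is the event that \<open>P\<close> gives mass at least \<delta> to the
    complement of \<open>K\<close>, scaled to the threshold 1 of the Markov inequality for
    \<open>nn_integral\<close>.\<close>
  let ?B = "{P \<in> space M. 1 \<le> ennreal (1 / \<delta>) * ?u P}"
  have B: "?B \<in> sets M" using u by measurable
  have "emeasure M ?B \<le> ennreal (1 / \<delta>) * (\<integral>\<^sup>+P. ?u P * indicator (space M) P \<partial>M)"
    by (rule nn_integral_Markov_inequality[OF _ sets.top]) (use u in simp)
  also have "(\<integral>\<^sup>+P. ?u P * indicator (space M) P \<partial>M) = (\<integral>\<^sup>+P. ?u P \<partial>M)"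
    by (intro nn_integral_cong) simp
  also have "\<dots> = emeasure m (topspace X - K)"
    unfolding m_def by (rule emeasure_bind_prob_algebra[OF M_prob id Kc, symmetric])
  also have "ennreal (1 / \<delta>) * emeasure m (topspace X - K) = ennreal (measure m (topspace X - K) / \<delta>)"
    using pos by (simp add: m.emeasure_eq_measure ennreal_mult'[symmetric])
  finally have "measure M ?B \<le> measure m (topspace X - K) / \<delta>"
    using pos by (simp add: M.emeasure_eq_measure)
  also have "\<dots> < \<epsilon>" using K(3) pos by (simp add: pos_divide_less_eq)
  finally have small: "measure M ?B < \<epsilon>" .
  have "measure (Pi_fam \<alpha>) {p \<in> simplexM \<alpha>. (\<Sum>A\<in>{A\<in>\<alpha>. A \<inter> K \<noteq> {}}. p A) < 1 - \<delta>} < \<epsilon>" if \<alpha>: "\<alpha> \<in> \<A>" for \<alpha>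
  proof -
    let ?hull = "{A\<in>\<alpha>. A \<inter> K \<noteq> {}}"
    let ?bad = "{p \<in> simplexM \<alpha>. (\<Sum>A\<in>?hull. p A) < 1 - \<delta>}"
    have pm: "proj \<alpha> \<in> M \<rightarrow>\<^sub>M borel_of (simplex_top \<alpha>)"
      unfolding measurable_cong_sets[OF setsM refl] by (rule proj_measurable_tight_top[OF \<alpha>])
    have "(\<lambda>p. \<Sum>A\<in>?hull. p A) \<in> borel_measurable (borel_of (simplex_top \<alpha>))"
      by (intro borel_measurable_sum simplex_coordinate_measurable) simp
    then have "(\<lambda>p. \<Sum>A\<in>?hull. p A) -` {..<1 - \<delta>} \<inter> space (borel_of (simplex_top \<alpha>)) \<in> sets (borel_of (simplex_top \<alpha>))"
      by (rule measurable_sets) simp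
    also have "(\<lambda>p. \<Sum>A\<in>?hull. p A) -` {..<1 - \<delta>} \<inter> space (borel_of (simplex_top \<alpha>)) = ?bad" by auto
    finally have bad: "?bad \<in> sets (borel_of (simplex_top \<alpha>))" .
    have "measure (Pi_fam \<alpha>) ?bad = measure M (proj \<alpha> -` ?bad \<inter> space M)"
      unfolding proj[OF \<alpha>, symmetric] by (rule measure_distr[OF pm bad])
    also have "\<dots> \<le> measure M ?B"
    proof (rule M.finite_measure_mono[OF _ B], rule subsetI)
      fix P assume "P \<in> proj \<alpha> -` ?bad \<inter> space M"
      then have P: "P \<in> M1 X" "(\<Sum>A\<in>?hull. proj \<alpha> P A) < 1 - \<delta>" using spaceM by auto
      interpret P: prob_space P using P M1_D by blast
      note sets_P = M1_D(2)[OF P(1)]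
      have cells: "A \<in> sets P" if "A \<in> \<alpha>" for A
        using part[OF \<alpha>] that sets_P by (simp add: is_partition_def)
      have fin: "finite \<alpha>" using part[OF \<alpha>] by (simp add: is_partition_def)
      have "K \<subseteq> topspace X" using sets.sets_into_space[OF K'] by simp
      \<comment> \<open>The cells that meet \<open>K\<close> cover it, so their total mass is at
        least that of \<open>K\<close>. This holds for every partition, which is why one
        \<open>K\<close> serves all \<alpha>.\<close>
      then have "K \<subseteq> (\<Union>A\<in>?hull. A)" using Union_partition[OF \<alpha>] by blast
      then have "measure P K \<le> measure P (\<Union>A\<in>?hull. A)"
        using fin cells by (intro P.finite_measure_mono sets.finite_UN) auto
      also have "\<dots> \<le> (\<Sum>A\<in>?hull. measure P A)"
        using fin cells by (intro P.finite_measure_subadditive_finite) auto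
      also have "\<dots> = (\<Sum>A\<in>?hull. proj \<alpha> P A)" by (simp add: proj_def)
      finally have "measure P K < 1 - \<delta>" using P(2) by simp
      moreover have "measure P (space P - K) = 1 - measure P K"
        using K' sets_P by (intro P.prob_compl) simp
      ultimately have "\<delta> < measure P (topspace X - K)" using M1_D(3)[OF P(1)] by simp
      then have "1 \<le> 1 / \<delta> * measure P (topspace X - K)" using pos by (simp add: field_simps)
      then have "1 \<le> ennreal (1 / \<delta>) * ?u P"
        using pos by (simp add: P.emeasure_eq_measure ennreal_mult'[symmetric])
      then show "P \<in> ?B" using P(1) spaceM by simp
    qed
    also note small
    finally show ?thesis .
  qed
  then show ?thesis using K(1) by blast
qed

theorem mainTheorem10:
  fixes X :: "'a topology" and \<U> :: "'a set set" and \<A> :: "'a set set set"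
    and Pi_fam :: "'a set set \<Rightarrow> ('a set \<Rightarrow> real) measure"
  assumes polish: "Polish_space X"
    and basis: "countable_basis X \<U>"
    and parts: "\<forall>\<alpha>\<in>\<A>. is_partition X \<alpha> \<and> (\<forall>A\<in>\<alpha>. gen_by X \<U> A)"
    and directed: "directed_refinement \<A>"
    and resolv: "resolves X \<A>"
    and borel_prob: "\<forall>\<alpha>\<in>\<A>. prob_space (Pi_fam \<alpha>) \<and> sets (Pi_fam \<alpha>) = sets (borel_of (simplex_top \<alpha>))"
    and coherent: "\<forall>\<alpha>\<in>\<A>. \<forall>\<beta>\<in>\<A>. refines \<beta> \<alpha> \<longrightarrow>
                     Pi_fam \<alpha> = distr (Pi_fam \<beta>) (borel_of (simplex_top \<alpha>)) (phi \<alpha> \<beta>)"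
  shows "(\<exists>!Pi. radon_prob (tight_top X) Pi \<and>
            (\<forall>\<alpha>\<in>\<A>. distr Pi (borel_of (simplex_top \<alpha>)) (proj \<alpha>) = Pi_fam \<alpha>))
         \<longleftrightarrow>
         (\<forall>\<epsilon>>0. \<forall>\<delta>>0. \<exists>K. compactin (hat_top X \<U>) K \<and>
            (\<forall>\<alpha>\<in>\<A>. measure (Pi_fam \<alpha>)
               {p \<in> simplexM \<alpha>. (\<Sum>A\<in>{A\<in>\<alpha>. A \<inter> K \<noteq> {}}. p A) < 1 - \<delta>} < \<epsilon>))"
  (is "(\<exists>!Pi. ?proj Pi) \<longleftrightarrow> ?tight")
proof -
  have "resolving_partitions X \<U> \<A>"
    by (rule resolving_partitions.intro) (use polish basis parts directed resolv in simp_all)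
  moreover have "coherent_system_axioms \<A> Pi_fam"
    by (rule coherent_system_axioms.intro) (use borel_prob coherent in simp_all)
  ultimately interpret coherent_system X \<U> \<A> Pi_fam
    by (rule coherent_system.intro)
  show ?thesis
  proof
    assume "\<exists>!Pi. ?proj Pi"
    then obtain M where M: "?proj M" by (elim ex1E)
    show ?tight
    proof (intro allI impI)
      fix \<epsilon> \<delta> :: real assume pos: "\<epsilon> > 0" "\<delta> > 0"
      show "\<exists>K. compactin (hat_top X \<U>) K \<and>
            (\<forall>\<alpha>\<in>\<A>. measure (Pi_fam \<alpha>)
               {p \<in> simplexM \<alpha>. (\<Sum>A\<in>{A\<in>\<alpha>. A \<inter> K \<noteq> {}}. p A) < 1 - \<delta>} < \<epsilon>)"
        by (rule projections_tight[OF conjunct1[OF M] bspec[OF conjunct2[OF M]] pos])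
    qed
  next
    assume ?tight
    from radon_prob_exists[OF this] obtain M where M: "?proj M" by (elim exE)
    have "N = M" if N: "?proj N" for N
    proof (rule measure_on_tight_top_unique)
      show "sets N = sets (borel_of (tight_top X))" "sets M = sets (borel_of (tight_top X))" "prob_space N"
        using conjunct1[OF M] conjunct1[OF N] by (simp_all add: radon_prob_def)
    qed (use M N in simp)
    with M show "\<exists>!Pi. ?proj Pi" by (rule ex1I)
  qed
qed

end
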